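(* Let $K\subset\mathbb{R}^2$ be a strictly convex domain whose boundary $\partial K$ is an oval, with area $A_{\partial K}$ and perimeter $L_{\partial K}$, and let $\widetilde{A}_{E_{1/2}(\partial K)}$ denote the oriented area of the Wigner caustic of $\partial K$. Let $W_K$ denote the convex body for which $\partial W_K$ is the Wigner caustic type curve associated with $\partial K$. Then $$L_{\partial K}^2-4\pi A_{\partial K}-8\pi\left|\widetilde{A}_{E_{1/2}(\partial K)}\right|\geqslant 6\pi\, d_2^2(K,W_K),$$ where equality holds if and only if $\partial K$ is a curve of constant width, or the Minkowski support function of $\partial K$ is of the form $$p_{\partial K}(\theta)=a_0+a_2\cos2\theta+b_2\sin2\theta+\sum_{n\geqslant1,\ n\text{ odd}}(a_n\cos n\theta+b_n\sin n\theta)$$ with real coefficients.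
   Context: An oval is a smooth ($C^\infty$) regular closed simple curve in $\mathbb{R}^2$ that is convex, i.e. its signed curvature has constant sign (in particular it is nowhere zero). Let $M=\partial K$. Fix an origin $O$ inside $M$ and orient $M$ positively. For $\theta\in\mathbb{R}$ let $p_M(\theta)$ be the Minkowski support function of $M$: the oriented distance from $O$ to the tangent line of $M$ whose outer normal is $(\cos\theta,\sin\theta)$. It is $2\pi$-periodic, and $M$ is parametrized by $\gamma(\theta)=\big(p_M(\theta)\cos\theta-p_M'(\theta)\sin\theta,\ p_M(\theta)\sin\theta+p_M'(\theta)\cos\theta\big)$, with radius of curvature $p_M+p_M''>0$. A parallel pair of $M$ is a pair of distinct points $a,b\in M$ at which the tangent lines are parallel. The Wigner caustic is $E_{1/2}(M)=\{\tfrac12 a+\tfrac12 b: a,b\text{ a parallel pair of }M\}$, parametrized by $\gamma_{1/2}(\theta)=\tfrac12\gamma(\theta)+\tfrac12\gamma(\theta+\pi)$, $\theta\in[0,\pi]$ (one traversal). Its oriented area is $\widetilde{A}_{E_{1/2}(M)}=\frac12\int_0^\pi(\gamma_{1/2,1}\gamma_{1/2,2}'-\gamma_{1/2,2}\gamma_{1/2,1}')\,d\theta$. The Wigner caustic type curve associated with $M$ is the curve $W_M$ with support function $$p_{W_M}(\theta)=\frac{L_M}{2\pi}+\frac{p_M(\theta)-p_M(\theta+\pi)}{2},$$ where $L_M$ is the length of $M$. So $p_{\partial W_K}=p_{W_{\partial K}}$, and $W_K$ enters the claim only through this function. For $K,N$ with support functions $p_{\partial K},p_{\partial N}$, $d_2(K,N)=\left(\int_0^{2\pi}|p_{\partial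 K}(\theta)-p_{\partial N}(\theta)|^2\,d\theta\right)^{1/2}$. An oval has constant width if the distance between every pair of (distinct) parallel tangent lines is the same, i.e. $p_M(\theta)+p_M(\theta+\pi)$ is constant. *)

theory Defs
  imports "HOL-Analysis.Analysis"
begin

section \<open>Ovals\<close>

definition vderiv :: "(real \<Rightarrow> real^2) \<Rightarrow> real \<Rightarrow> real^2" where
  "vderiv c t = vector_derivative c (at t)"

definition smooth_curve :: "(real \<Rightarrow> real^2) \<Rightarrow> bool" where
  "smooth_curve c \<longleftrightarrow> (\<forall>k t. (vderiv ^^ k) c differentiable at t)"

definition cross2 :: "real^2 \<Rightarrow> real^2 \<Rightarrow> real" where
  "cross2 v w = v $ 1 * w $ 2 - v $ 2 * w $ 1"

definition signed_curvature :: "(real \<Rightarrow> real^2) \<Rightarrow> real \<Rightarrow> real" where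
  "signed_curvature c t = cross2 (vderiv c t) (vderiv (vderiv c) t) / norm (vderiv c t) ^ 3"

text \<open>A smooth closed curve is given by a parametrisation of the whole line with some period
  \<open>T\<close>, so that all derivatives match at the closing point. Both orientations are allowed.\<close>

definition oval :: "(real \<Rightarrow> real^2) \<Rightarrow> real \<Rightarrow> bool" where
  "oval c T \<longleftrightarrow>
     0 < T \<and> smooth_curve c \<and> (\<forall>t. c (t + T) = c t) \<and> inj_on c {0..<T} \<and>
     (\<forall>t. vderiv c t \<noteq> 0) \<and>
     ((\<forall>t. signed_curvature c t > 0) \<or> (\<forall>t. signed_curvature c t < 0))"

definition curve_length :: "(real \<Rightarrow> real^2) \<Rightarrow> real \<Rightarrow> real" where
  "curve_length c T = integral {0..T} (\<lambda>t. norm (vderiv c t))"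

text \<open>Strict convexity is required of the closure, so that the notion is the same for open and for
  closed domains (for an open set the condition on the set itself would be mere convexity).\<close>

definition strictly_convex_domain :: "(real^2) set \<Rightarrow> bool" where
  "strictly_convex_domain K \<longleftrightarrow>
     interior K \<noteq> {} \<and>
     (\<forall>x\<in>closure K. \<forall>y\<in>closure K. x \<noteq> y \<longrightarrow> open_segment x y \<subseteq> interior K)"

definition tangent_line :: "(real \<Rightarrow> real^2) \<Rightarrow> real \<Rightarrow> (real^2) set" where
  "tangent_line c t = {c t + s *\<^sub>R vderiv c t | s. True}"

definition parallel_tangents :: "(real \<Rightarrow> real^2) \<Rightarrow> real \<Rightarrow> real \<Rightarrow> bool" where
  "parallel_tangents c s t \<longleftrightarrow> (\<exists>r. vderiv c s = r *\<^sub>R vderiv c t)"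

definition constant_width :: "(real \<Rightarrow> real^2) \<Rightarrow> bool" where
  "constant_width c \<longleftrightarrow>
     (\<exists>w. \<forall>s t. parallel_tangents c s t \<and> tangent_line c s \<noteq> tangent_line c t \<longrightarrow>
        setdist (tangent_line c s) (tangent_line c t) = w)"

section \<open>The Minkowski support function\<close>

definition unit_dir :: "real \<Rightarrow> real^2" where
  "unit_dir \<theta> = vector [cos \<theta>, sin \<theta>]"

definition outer_normal_at :: "(real^2) set \<Rightarrow> (real \<Rightarrow> real^2) \<Rightarrow> real \<Rightarrow> real^2 \<Rightarrow> bool" where
  "outer_normal_at K c t u \<longleftrightarrow> u \<bullet> vderiv c t = 0 \<and> (\<forall>x\<in>K. u \<bullet> (x - c t) \<le> 0)"

text \<open>The oriented distance from the origin \<open>z\<close> to the tangent line of the boundary curve \<open>c\<close> of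
  \<open>K\<close> whose outer normal is \<open>unit_dir \<theta>\<close>.\<close>

definition minkowski_support ::
  "(real^2) set \<Rightarrow> (real \<Rightarrow> real^2) \<Rightarrow> real^2 \<Rightarrow> real \<Rightarrow> real" where
  "minkowski_support K c z \<theta> =
     (THE h. \<exists>t. outer_normal_at K c t (unit_dir \<theta>) \<and> h = unit_dir \<theta> \<bullet> (c t - z))"

text \<open>The curve with support function \<open>p\<close>, in coordinates centred at the origin with respect to
  which \<open>p\<close> is taken.\<close>

definition support_param :: "(real \<Rightarrow> real) \<Rightarrow> real \<Rightarrow> real^2" where
  "support_param p \<theta> =
     vector [p \<theta> * cos \<theta> - deriv p \<theta> * sin \<theta>, p \<theta> * sin \<theta> + deriv p \<theta> * cos \<theta>]"

section \<open>Wigner caustic and Wigner caustic type curve\<close>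

definition wigner_caustic :: "(real \<Rightarrow> real) \<Rightarrow> real \<Rightarrow> real^2" where
  "wigner_caustic p \<theta> =
     (1/2) *\<^sub>R support_param p \<theta> + (1/2) *\<^sub>R support_param p (\<theta> + pi)"

text \<open>For \<open>\<theta>\<close> in \<open>[0, pi]\<close> the Wigner caustic is traversed exactly once.\<close>

definition wigner_caustic_area :: "(real \<Rightarrow> real) \<Rightarrow> real" where
  "wigner_caustic_area p =
     1/2 * integral {0..pi} (\<lambda>\<theta>. cross2 (wigner_caustic p \<theta>) (vderiv (wigner_caustic p) \<theta>))"

definition wigner_type_support :: "real \<Rightarrow> (real \<Rightarrow> real) \<Rightarrow> real \<Rightarrow> real" where
  "wigner_type_support L p \<theta> = L / (2 * pi) + (p \<theta> - p (\<theta> + pi)) / 2"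

text \<open>The distance of two bodies, in terms of their support functions. The function
  \<^const>\<open>wigner_type_support\<close> need not be the support function of a convex body.\<close>

definition d2 :: "(real \<Rightarrow> real) \<Rightarrow> (real \<Rightarrow> real) \<Rightarrow> real" where
  "d2 p q = sqrt (integral {0..2 * pi} (\<lambda>\<theta>. \<bar>p \<theta> - q \<theta>\<bar>\<^sup>2))"

end

theory Submission
  imports Defs
begin

text \<open>Write \<open>p\<close> for the support function. Its even part (with respect to \<open>\<theta> \<mapsto> \<theta> + pi\<close>)
is \<open>L / (2 * pi) + e\<close> with \<open>e\<close> of mean zero, and its odd part is
\<open>h \<theta> = (p \<theta> - p (\<theta> + pi)) / 2\<close>. Once it is known that \<open>p\<close> is twice continuously
differentiable and that
\<open>L = \<integral> p\<close> and \<open>A = 1/2 \<integral> p (p + p'')\<close> over \<open>[0, 2 pi]\<close>, everything becomes a statement about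
these two parts. Even and odd part do not interact in the quadratic form \<open>A\<close>. The Wigner caustic
has support function \<open>h\<close>, so its oriented area is \<open>1/2 \<integral> (h\<^sup>2 - h'\<^sup>2)\<close> over \<open>[0, pi]\<close>, which is not
positive by Wirtinger's inequality for antiperiodic functions. With the sign known, the term
\<open>8 pi\<close> times its absolute value is exactly the contribution of \<open>h\<close> to the isoperimetric
deficit. What remains of the left-hand side is \<open>4 pi \<integral> (e'\<^sup>2 - e\<^sup>2)\<close>, while the right-hand side is
\<open>12 pi \<integral> e\<^sup>2\<close>, both over \<open>[0, pi]\<close>, because \<open>e\<close> is the difference of the two support functions.
So the claim is \<open>\<integral> e'\<^sup>2 \<ge> 4 \<integral> e\<^sup>2\<close>, Wirtinger's inequality for functions with period \<open>pi\<close> and mean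
zero, in which equality means that \<open>e\<close> is a combination of \<open>cos 2\<theta>\<close> and \<open>sin 2\<theta>\<close>. Constant
width is the special case \<open>e = 0\<close>.

Both Wirtinger inequalities come from one integral identity between zeros of a function
(\<open>wirtinger_between_zeros\<close>), applied at suitable zeros. Passing between \<open>e\<close> and the expansion
of \<open>p\<close> in the equality case needs the pointwise convergence of the Fourier series of \<open>h\<close>
(\<open>antiperiodic_odd_fourier_series\<close>).

The geometric half provides the facts about \<open>p\<close>. The curvature has a sign, so a supporting line
at a boundary point can only lie on one side of the tangent, and the normal angle is a strictly
monotone function of the parameter. Strict convexity forces it to increase by exactly \<open>2 pi\<close> in
one period: if it turned further, two boundary points would share an outer normal. The inverse
function parametrises the curve by its normal angle (\<open>normal_parametrization_exists\<close>), and
substitution gives the derivatives of \<open>p\<close> and the length formula. The area formula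
(\<open>area_enclosed_by_star_shaped_curve\<close>) compares two maps with the same Jacobian, one onto the
domain and one onto a rectangle.\<close>

section \<open>Primitives and integrals over a period\<close>

lemma antiderivative_on_UNIV:
  fixes f :: "real \<Rightarrow> real"
  assumes "continuous_on UNIV f"
  obtains F where "\<And>x. (F has_real_derivative f x) (at x)"
proof -
  have "\<exists>F. \<forall>x::real. -\<infinity> < ereal x \<longrightarrow> ereal x < \<infinity> \<longrightarrow> (F has_vector_derivative f x) (at x)"
    by (rule einterval_antiderivative) (use assms in \<open>auto simp: continuous_on_eq_continuous_at\<close>)
  then show ?thesis
    using that by (auto simp: has_real_derivative_iff_has_vector_derivative)
qed

lemma integral_eq_increment:
  fixes F :: "real \<Rightarrow> real"
  assumes "\<And>x. (F has_real_derivative f x) (at x)" "a \<le> b"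
  shows "(f has_integral (F b - F a)) {a..b}"
  using assms
  by (intro fundamental_theorem_of_calculus)
     (auto simp: has_real_derivative_iff_has_vector_derivative intro: has_vector_derivative_at_within)

text \<open>The increment of a primitive over one period does not depend on the starting point, since the
increment has derivative zero by periodicity of \<open>f\<close>.\<close>
lemma integral_over_period:
  fixes f :: "real \<Rightarrow> real"
  assumes cont: "continuous_on UNIV f" and per: "\<And>x. f (x + l) = f x" and "l \<ge> 0"
  shows "integral {a..a+l} f = integral {0..l} f"
proof -
  obtain F where F: "\<And>x. (F has_real_derivative f x) (at x)"
    using antiderivative_on_UNIV[OF cont] by blast
  have "((\<lambda>x. F (x + l) - F x) has_real_derivative 0) (at x)" for x
  proof -
    have "((\<lambda>x. F (x + l)) has_real_derivative f (x + l)) (at x)"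
      using F[of "x+l"] DERIV_shift by blast
    then show ?thesis using F[of x] per[of x] by (auto intro!: derivative_eq_intros)
  qed
  then have "F (a + l) - F a = F (0 + l) - F 0"
    by (rule DERIV_isconst_all[rule_format, of "\<lambda>x. F (x + l) - F x"]) 
  then show ?thesis
    using integral_eq_increment[of F f, OF F] \<open>l \<ge> 0\<close>
    by (metis (no_types) add.left_neutral integral_unique le_add_same_cancel1)
qed

lemma deriv_imp_continuous_on_UNIV:
  fixes f :: "real \<Rightarrow> real"
  assumes "\<And>x. (f has_real_derivative f' x) (at x)"
  shows "continuous_on A f"
  by (intro continuous_at_imp_continuous_on ballI DERIV_isCont[OF assms])


lemma deriv_shift:
  fixes f :: "real \<Rightarrow> real"
  assumes "\<And>x. (f has_real_derivative f' x) (at x)"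
  shows "((\<lambda>x. f (x + a)) has_real_derivative f' (x + a)) (at x)"
  using assms[of "x + a"] DERIV_shift by blast

lemma integral_fold_half_period:
  fixes q :: "real \<Rightarrow> real"
  assumes "continuous_on UNIV q"
  shows "integral {0..2*pi} q = integral {0..pi} (\<lambda>x. q x + q (x + pi))"
proof -
  have c: "q integrable_on {a..b}" "continuous_on A q" for a b A
    by (intro integrable_continuous_interval continuous_on_subset[OF assms], simp)+
  have i: "(\<lambda>x. q (x + pi)) integrable_on {0..pi}"
    by (intro integrable_continuous_interval continuous_on_compose2[OF assms] continuous_intros) auto
  have "integral {0..2*pi} q = integral {0..pi} q + integral {pi..2*pi} q"
    by (rule Henstock_Kurzweil_Integration.integral_combine[symmetric]) (use c in auto)
  also have "integral {pi..2*pi} q = integral {0..pi} (\<lambda>x. q (x + pi))"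
    using integral_shift_Icc_real[of 0 pi q pi] by (simp add: o_def add.commute)
  also have "integral {0..pi} q + \<dots> = integral {0..pi} (\<lambda>x. q x + q (x + pi))"
    by (rule integral_add[symmetric]) (use c i in auto)
  finally show ?thesis .
qed

section \<open>Wirtinger inequalities\<close>

text \<open>This limit is what makes a quotient by a sine extend continuously to a simple zero, both in the
Wirtinger inequality and for the kernel of the Fourier partial sums.\<close>
lemma quotient_of_zeros_tendsto:
  fixes f s :: "real \<Rightarrow> real"
  assumes "(f has_real_derivative D) (at c)" "(s has_real_derivative S) (at c)"
    and "f c = 0" "s c = 0" "S \<noteq> 0"
  shows "((\<lambda>x. f x / s x) \<longlongrightarrow> D / S) (at c)"
proof -
  have "((\<lambda>x. ((f x - f c) / (x - c)) / ((s x - s c) / (x - c))) \<longlongrightarrow> D / S) (at c)"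
    using assms by (intro tendsto_divide) (auto simp: has_field_derivative_iff)
  moreover have "\<forall>\<^sub>F x in at c. ((f x - f c) / (x - c)) / ((s x - s c) / (x - c)) = f x / s x"
    using assms by (auto simp: eventually_at_filter)
  ultimately show ?thesis by (rule Lim_transform_eventually)
qed

lemma square_over_sine_isCont:
  fixes f s :: "real \<Rightarrow> real"
  assumes "(f has_real_derivative D) (at c)" "(s has_real_derivative S) (at c)"
    and "f c = 0" "s c = 0" "S \<noteq> 0"
  shows "isCont (\<lambda>x. (f x)\<^sup>2 / s x) c"
proof -
  have "isCont f c" using assms(1) DERIV_isCont by blast
  then have "((\<lambda>x. f x * (f x / s x)) \<longlongrightarrow> f c * (D / S)) (at c)"
    using quotient_of_zeros_tendsto[OF assms] by (intro tendsto_mult) (auto simp: isCont_def)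
  then show ?thesis using assms by (simp add: isCont_def power2_eq_square)
qed

text \<open>With \<open>s = sin (k (x - a))\<close>, the function \<open>F = f\<^sup>2 k cot (k (x - a))\<close> satisfies
\<open>F' = f'\<^sup>2 - k\<^sup>2 f\<^sup>2 - (f' - k f cot (k (x - a)))\<^sup>2\<close> and tends to \<open>0\<close> at both ends, because \<open>f\<close> vanishes there
to first order. Integrating, \<open>\<integral> (f'\<^sup>2 - k\<^sup>2 f\<^sup>2)\<close> is the integral of a square, and equality forces
the square to vanish. Division by zero gives \<open>F\<close> the value \<open>0\<close> at the end points, which is
the right limit.\<close>
lemma wirtinger_between_zeros:
  fixes f f' :: "real \<Rightarrow> real"
  assumes "k > 0"
    and der: "\<And>x. (f has_real_derivative f' x) (at x)"
    and cont: "continuous_on UNIV f'"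
    and fa: "f a = 0" and fb: "f b = 0" and b: "b = a + pi / k"
  shows "integral {a..b} (\<lambda>x. (f' x)\<^sup>2) \<ge> k\<^sup>2 * integral {a..b} (\<lambda>x. (f x)\<^sup>2)"
    and "integral {a..b} (\<lambda>x. (f' x)\<^sup>2) = k\<^sup>2 * integral {a..b} (\<lambda>x. (f x)\<^sup>2) \<Longrightarrow> x \<in> {a..b} \<Longrightarrow>
          f' x * sin (k * (x - a)) = k * f x * cos (k * (x - a))"
proof -
  define s where "s x = sin (k * (x - a))" for x
  define co where "co x = cos (k * (x - a))" for x
  define w where "w x = f' x - k * f x * co x / s x" for x
  define F where "F x = (f x)\<^sup>2 / s x * (k * co x)" for x
  define q where "q x = (f' x)\<^sup>2 - k\<^sup>2 * (f x)\<^sup>2" for x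
  have ab: "a < b" using b \<open>k > 0\<close> by simp
  have ds: "(s has_real_derivative k * co x) (at x)" for x
    unfolding s_def co_def by (auto intro!: derivative_eq_intros)
  have dco: "(co has_real_derivative - k * s x) (at x)" for x
    unfolding s_def co_def by (auto intro!: derivative_eq_intros)
  have s0: "s a = 0" "s b = 0" "co a = 1" "co b = -1"
    using b \<open>k > 0\<close> by (auto simp: s_def co_def)
  have spos: "s x > 0" if "x \<in> {a<..<b}" for x
    unfolding s_def using that b \<open>k > 0\<close> by (intro sin_gt_zero) (auto simp: field_simps)
  have dF: "(F has_real_derivative q x - (w x)\<^sup>2) (at x)" if "x \<in> {a<..<b}" for x
  proof -
    have s: "s x \<noteq> 0" using spos[OF that] by simp
    have "(F has_real_derivative
        (2 * f x * f' x * s x - (f x)\<^sup>2 * (k * co x)) / (s x)\<^sup>2 * (k * co x)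
         + (f x)\<^sup>2 / s x * (k * (- k * s x))) (at x)"
      unfolding F_def using s
      by (auto intro!: derivative_eq_intros der ds dco simp: power2_eq_square field_simps)
    also have "(2 * f x * f' x * s x - (f x)\<^sup>2 * (k * co x)) / (s x)\<^sup>2 * (k * co x)
         + (f x)\<^sup>2 / s x * (k * (- k * s x)) = q x - (w x)\<^sup>2"
      unfolding q_def w_def using s by (simp add: field_simps power2_eq_square)
    finally show ?thesis .
  qed
  have cco: "isCont co x" for x using dco DERIV_isCont by blast
  have "isCont F x" if "x \<in> {a..b}" for x
  proof (cases "x \<in> {a<..<b}")
    case True then show ?thesis using dF DERIV_isCont by blast
  next
    case False
    then have "x = a \<or> x = b" using that by auto
    then have c0: "isCont (\<lambda>x. (f x)\<^sup>2 / s x) x"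
      using square_over_sine_isCont[OF der[of x] ds[of x]] fa fb s0 \<open>k > 0\<close> by force
    show ?thesis unfolding F_def by (rule isCont_mult[OF c0]) (intro continuous_mult continuous_const cco)
  qed
  then have cF: "continuous_on {a..b} F" by (simp add: continuous_at_imp_continuous_on)
  have "((\<lambda>x. q x - (w x)\<^sup>2) has_integral (F b - F a)) {a..b}"
    using ab cF dF by (intro fundamental_theorem_of_calculus_interior)
      (auto simp: has_real_derivative_iff_has_vector_derivative)
  then have i0: "((\<lambda>x. q x - (w x)\<^sup>2) has_integral 0) {a..b}" using s0 by (simp add: F_def)
  have cf: "continuous_on UNIV f"
    by (intro continuous_at_imp_continuous_on ballI DERIV_isCont[OF der])
  have if': "(\<lambda>x. (f' x)\<^sup>2) integrable_on {a..b}" and iff: "(\<lambda>x. (f x)\<^sup>2) integrable_on {a..b}"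
    by (intro integrable_continuous_interval continuous_on_power continuous_on_subset[OF cont]
        continuous_on_subset[OF cf] subset_UNIV)+
  define I where "I = integral {a..b} (\<lambda>x. (f' x)\<^sup>2) - k\<^sup>2 * integral {a..b} (\<lambda>x. (f x)\<^sup>2)"
  have iq: "(q has_integral I) {a..b}"
    unfolding q_def I_def using if' iff
    by (intro has_integral_diff has_integral_mult_right) (auto simp: has_integral_integral)
  have iw: "((\<lambda>x. (w x)\<^sup>2) has_integral I) {a..b}"
    using has_integral_diff[OF iq i0] by simp
  show "integral {a..b} (\<lambda>x. (f' x)\<^sup>2) \<ge> k\<^sup>2 * integral {a..b} (\<lambda>x. (f x)\<^sup>2)"
    using has_integral_nonneg[OF iw] by (simp add: I_def)
  assume eq: "integral {a..b} (\<lambda>x. (f' x)\<^sup>2) = k\<^sup>2 * integral {a..b} (\<lambda>x. (f x)\<^sup>2)"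
    and x: "x \<in> {a..b}"
  show "f' x * sin (k * (x - a)) = k * f x * cos (k * (x - a))"
  proof (cases "x \<in> {a<..<b}")
    case False
    then have "x = a \<or> x = b" using x by auto
    then show ?thesis using fa fb s0 by (auto simp: s_def)
  next
    case True
    define d where "d = (a + x) / 2"
    define e where "e = (x + b) / 2"
    have de: "a < d" "d < x" "x < e" "e < b" using True by (auto simp: d_def e_def field_simps)
    have iwde: "(\<lambda>x. (w x)\<^sup>2) integrable_on {d..e}"
      by (rule integrable_on_subinterval[OF has_integral_integrable[OF iw]]) (use de in auto)
    have "integral {d..e} (\<lambda>x. (w x)\<^sup>2) \<le> integral {a..b} (\<lambda>x. (w x)\<^sup>2)"
      using has_integral_integrable[OF iw] iwde de by (intro integral_subset_le) auto
    also have "\<dots> = 0" using iw eq by (simp add: I_def integral_unique)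
    finally have "((\<lambda>x. (w x)\<^sup>2) has_integral 0) {d..e}"
      using iwde integral_nonneg[OF iwde] by (simp add: has_integral_integrable_integral)
    moreover have "continuous_on {d..e} (\<lambda>x. (w x)\<^sup>2)"
    proof -
      have "\<forall>y\<in>{d..e}. s y \<noteq> 0"
        using spos de by (metis atLeastAtMost_iff greaterThanLessThan_iff less_irrefl
            order.strict_trans1 order.strict_trans2)
      moreover have "continuous_on {d..e} s" "continuous_on {d..e} co"
        unfolding s_def co_def by (intro continuous_intros)+
      ultimately show ?thesis
        unfolding w_def using continuous_on_subset[OF cont] continuous_on_subset[OF cf]
        by (intro continuous_on_power continuous_on_diff continuous_on_divide continuous_on_mult
             continuous_on_const) auto
    qed
    ultimately have "(w x)\<^sup>2 = 0"
      using has_integral_0_cbox_imp_0[of d e "\<lambda>x. (w x)\<^sup>2" x] de by (auto simp: box_real)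
    then show ?thesis using spos[OF True] by (simp add: w_def field_simps s_def co_def)
  qed
qed

text \<open>An antiperiodic function changes sign and hence has a zero \<open>a\<close>, and then it also vanishes at
\<open>a + pi\<close>. By periodicity of the squares the interval may be moved back to \<open>[0, pi]\<close>.\<close>
lemma wirtinger_antiperiodic:
  fixes f f' :: "real \<Rightarrow> real"
  assumes der: "\<And>x. (f has_real_derivative f' x) (at x)"
    and cont: "continuous_on UNIV f'"
    and anti: "\<And>x. f (x + pi) = - f x"
  shows "integral {0..pi} (\<lambda>x. (f x)\<^sup>2) \<le> integral {0..pi} (\<lambda>x. (f' x)\<^sup>2)"
proof -
  have cf: "continuous_on A f" for A by (rule deriv_imp_continuous_on_UNIV[OF der])
  have anti': "f' (x + pi) = - f' x" for x
  proof -
    have "((\<lambda>x. f (x + pi)) has_real_derivative f' (x + pi)) (at x)"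
      by (rule deriv_shift[OF der])
    moreover have "((\<lambda>x. f (x + pi)) has_real_derivative - f' x) (at x)"
      unfolding anti using DERIV_minus[OF der] .
    ultimately show ?thesis by (rule DERIV_unique)
  qed
  obtain a where a: "f a = 0"
  proof (cases "f 0 \<le> 0")
    case True
    then show ?thesis
      using IVT'[of f 0 0 pi] cf[of "{0..pi}"] anti[of 0] that by auto
  next
    case False
    then show ?thesis
      using IVT2'[of f pi 0 0] cf[of "{0..pi}"] anti[of 0] that by auto
  qed
  have "integral {0..pi} (\<lambda>x. (f x)\<^sup>2) = integral {a..a+pi} (\<lambda>x. (f x)\<^sup>2)"
    by (rule integral_over_period[symmetric]) (auto simp: anti intro!: continuous_on_power cf)
  also have "\<dots> \<le> integral {a..a+pi} (\<lambda>x. (f' x)\<^sup>2)"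
  proof -
    have "f (a + pi) = 0" using a anti by simp
    from wirtinger_between_zeros(1)[OF zero_less_one der cont a this] show ?thesis by simp
  qed
  also have "\<dots> = integral {0..pi} (\<lambda>x. (f' x)\<^sup>2)"
    by (rule integral_over_period) (auto simp: anti' intro!: continuous_on_power cont)
  finally show ?thesis .
qed

text \<open>Differentiating the identity gives \<open>(f'' + 4 f) sin (2 (x - a)) = 0\<close>, and the zeros of the sine are
isolated, so \<open>f'' = -4 f\<close> by continuity. For solutions of this equation the two
quantities \<open>P\<close> and \<open>Q\<close> below are constants of motion, and they are the coefficients.\<close>
lemma double_frequency_of_deriv_identity:
  fixes f f1 f2 :: "real \<Rightarrow> real"
  assumes der: "\<And>x. (f has_real_derivative f1 x) (at x)"
    and der1: "\<And>x. (f1 has_real_derivative f2 x) (at x)"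
    and cont: "continuous_on UNIV f2"
    and eq: "\<And>x. f1 x * sin (2 * (x - a)) = 2 * f x * cos (2 * (x - a))"
  obtains A B where "\<And>x. f x = A * cos (2 * x) + B * sin (2 * x)"
proof -
  have prod: "(f2 x + 4 * f x) * sin (2 * (x - a)) = 0" for x
  proof -
    have "((\<lambda>x. f1 x * sin (2 * (x - a)) - 2 * f x * cos (2 * (x - a))) has_real_derivative
       (f2 x + 4 * f x) * sin (2 * (x - a))) (at x)"
      by (auto intro!: derivative_eq_intros der der1 simp: algebra_simps)
    moreover have "(\<lambda>x. f1 x * sin (2 * (x - a)) - 2 * f x * cos (2 * (x - a))) = (\<lambda>x. 0)"
      using eq by auto
    ultimately show ?thesis using DERIV_unique[OF _ DERIV_const] by metis
  qed
  have ode: "f2 x = - 4 * f x" for x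
  proof (cases "sin (2 * (x - a)) = 0")
    case False then show ?thesis using prod[of x] by simp
  next
    case True
    have "cos (2 * (x - a)) \<noteq> 0" using True sin_zero_abs_cos_one by fastforce
    moreover have "((\<lambda>x. sin (2 * (x - a))) has_real_derivative 2 * cos (2 * (x - a))) (at x)"
      by (auto intro!: derivative_eq_intros)
    ultimately have "((\<lambda>y. sin (2 * (y - a)) / (y - x)) \<longlongrightarrow> 2 * cos (2 * (x - a))) (at x)"
        "2 * cos (2 * (x - a)) \<noteq> 0"
      using True by (auto simp: has_field_derivative_iff)
    then have "\<forall>\<^sub>F y in at x. sin (2 * (y - a)) / (y - x) \<noteq> 0"
      by (rule tendsto_imp_eventually_ne)
    then have "\<forall>\<^sub>F y in at x. f2 y + 4 * f y = 0"
      by (rule eventually_mono) (use prod in force)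
    then have "((\<lambda>y. f2 y + 4 * f y) \<longlongrightarrow> 0) (at x)" by (rule tendsto_eventually)
    moreover have "isCont (\<lambda>y. f2 y + 4 * f y) x"
    proof -
      have "isCont f2 x" using cont by (simp add: continuous_on_eq_continuous_at)
      then show ?thesis by (intro continuous_add continuous_mult continuous_const DERIV_isCont[OF der])
    qed
    ultimately have "f2 x + 4 * f x = 0" unfolding isCont_def by (rule LIM_unique[OF _ _, rotated])
    then show ?thesis by simp
  qed
  define P where "P x = f x * cos (2 * x) - f1 x * sin (2 * x) / 2" for x
  define Q where "Q x = f x * sin (2 * x) + f1 x * cos (2 * x) / 2" for x
  have "(P has_real_derivative 0) (at x)" "(Q has_real_derivative 0) (at x)" for x
    unfolding P_def Q_def
    by (auto intro!: derivative_eq_intros der der1 simp: field_simps ode)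
  then have PQ: "P x = P 0" "Q x = Q 0" for x
    by (metis DERIV_isconst_all)+
  have "f x = P 0 * cos (2 * x) + Q 0 * sin (2 * x)" for x
  proof -
    have "P x * cos (2 * x) + Q x * sin (2 * x) = f x"
      unfolding P_def Q_def
      by (simp add: algebra_simps) (simp add: sin_cos_squared_add3 flip: distrib_left)
    then show ?thesis by (simp only: PQ[of x])
  qed
  then show ?thesis using that by blast
qed

text \<open>The function \<open>f x - f (x + pi/2)\<close> is antiperiodic with antiperiod \<open>pi/2\<close>, so \<open>f\<close> takes the same value
at some \<open>a\<close> and at \<open>a + pi/2\<close>. Then \<open>f - f a\<close> vanishes at three points with distance \<open>pi/2\<close>, and the
inequality between zeros with \<open>k = 2\<close> applies on both intervals. Since \<open>f\<close> has mean
zero, \<open>\<integral> (f - f a)\<^sup>2\<close> exceeds \<open>\<integral> f\<^sup>2\<close> by \<open>pi (f a)\<^sup>2\<close>, so equality also forces \<open>f a = 0\<close>.\<close>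
lemma wirtinger_period_pi:
  fixes f f1 f2 :: "real \<Rightarrow> real"
  assumes der: "\<And>x. (f has_real_derivative f1 x) (at x)"
    and der1: "\<And>x. (f1 has_real_derivative f2 x) (at x)"
    and cont: "continuous_on UNIV f2"
    and per: "\<And>x. f (x + pi) = f x"
    and mean: "integral {0..pi} f = 0"
  shows "4 * integral {0..pi} (\<lambda>x. (f x)\<^sup>2) \<le> integral {0..pi} (\<lambda>x. (f1 x)\<^sup>2)"
    and "integral {0..pi} (\<lambda>x. (f1 x)\<^sup>2) = 4 * integral {0..pi} (\<lambda>x. (f x)\<^sup>2) \<longleftrightarrow>
      (\<exists>A B. \<forall>x. f x = A * cos (2 * x) + B * sin (2 * x))"
proof -
  have cf: "continuous_on A f" for A by (rule deriv_imp_continuous_on_UNIV[OF der])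
  have cf1: "continuous_on A f1" for A by (rule deriv_imp_continuous_on_UNIV[OF der1])
  have per1: "f1 (x + pi) = f1 x" for x
  proof -
    have "((\<lambda>x. f (x + pi)) has_real_derivative f1 (x + pi)) (at x)"
      by (rule deriv_shift[OF der])
    then show ?thesis unfolding per using der[of x] by (rule DERIV_unique)
  qed
  define h where "h x = f x - f (x + pi / 2)" for x
  have ch: "continuous_on A h" for A
    unfolding h_def by (intro continuous_intros cf continuous_on_compose2[OF cf[of UNIV]]) auto
  have h0: "h (pi/2) = - h 0" using per[of 0] by (simp add: h_def)
  obtain a where "h a = 0"
  proof (cases "h 0 \<le> 0")
    case True
    then show ?thesis using IVT'[of h 0 0 "pi/2"] ch h0 that by auto
  next
    case False
    then show ?thesis using IVT2'[of h "pi/2" 0 0] ch h0 that by auto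
  qed
  then have a2: "f (a + pi / 2) = f a" by (simp add: h_def)
  define g where "g x = f x - f a" for x
  have dg: "(g has_real_derivative f1 x) (at x)" for x
    unfolding g_def by (auto intro!: derivative_eq_intros der)
  have cg: "continuous_on A g" for A by (rule deriv_imp_continuous_on_UNIV[OF dg])
  have g0: "g a = 0" "g (a + pi/2) = 0" "g (a + pi/2 + pi/2) = 0"
    using a2 per[of a] by (simp_all add: g_def add.commute[of pi a])
  have ints: "(\<lambda>x. (f1 x)\<^sup>2) integrable_on {c..d}" "(\<lambda>x. (g x)\<^sup>2) integrable_on {c..d}"
      "(\<lambda>x. (f x)\<^sup>2) integrable_on {c..d}" "f integrable_on {c..d}" for c d
    by (intro integrable_continuous_interval continuous_on_power cf1 cg cf)+
  note W1 = wirtinger_between_zeros[of 2 g f1 a "a + pi/2", OF _ dg cf1 g0(1,2)]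
  note W2 = wirtinger_between_zeros[of 2 g f1 "a + pi/2" "a + pi/2 + pi/2", OF _ dg cf1 g0(2,3)]
  have split: "integral {0..pi} q = integral {a..a+pi/2} q + integral {a+pi/2..a+pi/2+pi/2} q"
    if "continuous_on UNIV q" "\<And>x. q (x + pi) = q x" for q :: "real \<Rightarrow> real"
  proof -
    have "q integrable_on {a..a+pi}"
      by (intro integrable_continuous_interval continuous_on_subset[OF that(1)]) auto
    then have "integral {a..a+pi/2} q + integral {a+pi/2..a+pi} q = integral {a..a+pi} q"
      by (intro Henstock_Kurzweil_Integration.integral_combine) auto
    moreover have "a + pi / 2 + pi / 2 = a + pi" by simp
    ultimately show ?thesis using integral_over_period[OF that(1) that(2), of a] by (simp only:) simp
  qed
  have s1: "integral {0..pi} (\<lambda>x. (f1 x)\<^sup>2) = integral {a..a+pi/2} (\<lambda>x. (f1 x)\<^sup>2) +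
      integral {a+pi/2..a+pi/2+pi/2} (\<lambda>x. (f1 x)\<^sup>2)"
    by (rule split) (auto simp: per1 intro!: continuous_on_power cf1)
  have s2: "integral {0..pi} (\<lambda>x. (g x)\<^sup>2) = integral {a..a+pi/2} (\<lambda>x. (g x)\<^sup>2) +
      integral {a+pi/2..a+pi/2+pi/2} (\<lambda>x. (g x)\<^sup>2)"
    by (rule split) (auto simp: per g_def intro!: continuous_on_power continuous_on_diff cf)
  have s3: "integral {0..pi} (\<lambda>x. (g x)\<^sup>2) = integral {0..pi} (\<lambda>x. (f x)\<^sup>2) + pi * (f a)\<^sup>2"
  proof -
    have "(f has_integral 0) {0..pi}" using ints(4) mean by (metis integrable_integral)
    then have "((\<lambda>x. (f x)\<^sup>2 - 2 * f a * f x + (f a)\<^sup>2) has_integral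
        integral {0..pi} (\<lambda>x. (f x)\<^sup>2) - 2 * f a * 0 + (pi - 0) *\<^sub>R (f a)\<^sup>2) {0..pi}"
      using has_integral_const_real[of "(f a)\<^sup>2" 0 pi]
      by (intro has_integral_add has_integral_diff has_integral_mult_right integrable_integral ints) simp_all
    moreover have "(g x)\<^sup>2 = (f x)\<^sup>2 - 2 * f a * f x + (f a)\<^sup>2" for x
      by (simp add: g_def power2_diff)
    ultimately show ?thesis by (simp add: integral_unique)
  qed
  show ge: "4 * integral {0..pi} (\<lambda>x. (f x)\<^sup>2) \<le> integral {0..pi} (\<lambda>x. (f1 x)\<^sup>2)"
    using W1(1) W2(1) s1 s2 s3 by (simp add: field_simps) 
       (smt (verit) pi_gt_zero zero_le_mult_iff zero_le_power2)
  show "integral {0..pi} (\<lambda>x. (f1 x)\<^sup>2) = 4 * integral {0..pi} (\<lambda>x. (f x)\<^sup>2) \<longleftrightarrow>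
      (\<exists>A B. \<forall>x. f x = A * cos (2 * x) + B * sin (2 * x))" (is "?eq \<longleftrightarrow> ?form")
  proof
    assume eq: ?eq
    have w1: "integral {a..a+pi/2} (\<lambda>x. (f1 x)\<^sup>2) \<ge> 4 * integral {a..a+pi/2} (\<lambda>x. (g x)\<^sup>2)"
      and w2: "integral {a+pi/2..a+pi/2+pi/2} (\<lambda>x. (f1 x)\<^sup>2) \<ge>
          4 * integral {a+pi/2..a+pi/2+pi/2} (\<lambda>x. (g x)\<^sup>2)"
      using W1(1) W2(1) by simp_all
    have "0 \<le> pi * (f a)\<^sup>2" by simp
    then have "pi * (f a)\<^sup>2 = 0" using w1 w2 eq s1 s2 s3 by argo
    then have fa: "f a = 0" by simp
    then have gf: "g = f" by (auto simp: g_def)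
    have e1: "integral {a..a+pi/2} (\<lambda>x. (f1 x)\<^sup>2) = 4 * integral {a..a+pi/2} (\<lambda>x. (g x)\<^sup>2)"
      and e2: "integral {a+pi/2..a+pi/2+pi/2} (\<lambda>x. (f1 x)\<^sup>2) =
          4 * integral {a+pi/2..a+pi/2+pi/2} (\<lambda>x. (g x)\<^sup>2)"
      using w1 w2 eq s1 s2 s3 \<open>pi * (f a)\<^sup>2 = 0\<close> by argo+
    have base: "f1 x * sin (2 * (x - a)) = 2 * f x * cos (2 * (x - a))" if "x \<in> {a..a+pi}" for x
    proof (cases "x \<le> a + pi / 2")
      case True
      then show ?thesis using W1(2)[of x] e1 that by (simp add: gf)
    next
      case False
      have "2 * (x - (a + pi/2)) = 2 * (x - a) - pi" by (simp add: algebra_simps)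
      then have "sin (2 * (x - (a + pi/2))) = - sin (2 * (x - a))"
         "cos (2 * (x - (a + pi/2))) = - cos (2 * (x - a))"
        by (simp_all only: sin_diff cos_diff) simp_all
      then show ?thesis using W2(2)[of x] e2 that False by (simp add: gf)
    qed
    have all: "f1 x * sin (2 * (x - a)) = 2 * f x * cos (2 * (x - a))" for x
    proof -
      define D where "D x = f1 x * sin (2 * (x - a)) - 2 * f x * cos (2 * (x - a))" for x
      have perD: "D (x + pi) = D x" for x
      proof -
        have "2 * (x + pi - a) = 2 * (x - a) + 2 * pi" by simp
        then show ?thesis unfolding D_def per per1 by (simp only: sin_periodic cos_periodic)
      qed
      interpret P: periodic_fun_simple D pi by standard (rule perD)
      define n where "n = \<lfloor>(x - a) / pi\<rfloor>"
      have "of_int n \<le> (x - a) / pi" "(x - a) / pi < of_int n + 1" unfolding n_def by linarith+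
      then have "x - of_int n * pi \<in> {a..a+pi}"
        by (auto simp: field_simps)
      from base[OF this] have "D (x - of_int n * pi) = 0" unfolding D_def by linarith
      then show ?thesis using P.minus_of_int[of x n] by (simp add: D_def)
    qed
    then show ?form
      by (rule double_frequency_of_deriv_identity[OF der der1 cont]) blast
  next
    assume ?form
    then obtain A B where f: "\<And>x. f x = A * cos (2 * x) + B * sin (2 * x)" by blast
    have f1: "f1 x = - 2 * A * sin (2 * x) + 2 * B * cos (2 * x)" for x
    proof -
      have "(f has_real_derivative - 2 * A * sin (2 * x) + 2 * B * cos (2 * x)) (at x)"
        unfolding f[abs_def] by (auto intro!: derivative_eq_intros)
      then show ?thesis using der DERIV_unique by blast
    qed
    have "((\<lambda>x. (f1 x)\<^sup>2 - 4 * (f x)\<^sup>2) has_integral f pi * f1 pi - f 0 * f1 0) {0..pi}"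
    proof (rule integral_eq_increment)
      fix x
      have "(f1 has_real_derivative - 4 * f x) (at x)"
        unfolding f1[abs_def] f by (auto intro!: derivative_eq_intros)
      then show "((\<lambda>x. f x * f1 x) has_real_derivative (f1 x)\<^sup>2 - 4 * (f x)\<^sup>2) (at x)"
        by (auto intro!: derivative_eq_intros der simp: power2_eq_square)
    qed simp
    moreover have "((\<lambda>x. (f1 x)\<^sup>2 - 4 * (f x)\<^sup>2) has_integral
       integral {0..pi} (\<lambda>x. (f1 x)\<^sup>2) - 4 * integral {0..pi} (\<lambda>x. (f x)\<^sup>2)) {0..pi}"
      using ints by (intro has_integral_diff has_integral_mult_right) (auto simp: has_integral_integral)
    ultimately have "f pi * f1 pi - f 0 * f1 0 =
       integral {0..pi} (\<lambda>x. (f1 x)\<^sup>2) - 4 * integral {0..pi} (\<lambda>x. (f x)\<^sup>2)"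
      by (rule has_integral_unique)
    moreover have "f pi = f 0" "f1 pi = f1 0" using per[of 0] per1[of 0] by simp_all
    ultimately show ?eq by simp
  qed
qed

section \<open>Fourier series of antiperiodic functions\<close>

text \<open>By Weierstrass approximation it suffices to consider a polynomial, for which integration by parts
gains a factor \<open>1 / r\<close>.\<close>
lemma riemann_lebesgue_sin:
  fixes g :: "real \<Rightarrow> real"
  assumes cont: "continuous_on {a..b} g" and "a \<le> b"
  shows "((\<lambda>r. integral {a..b} (\<lambda>t. g t * sin (r * t))) \<longlongrightarrow> 0) at_top"
proof (rule tendstoI)
  fix e :: real assume "e > 0"
  define w where "w = b - a + 1"
  have w: "w > 0" using \<open>a \<le> b\<close> by (simp add: w_def)
  define d where "d = e / (2 * w)"
  have d: "d > 0" using \<open>e > 0\<close> w by (simp add: d_def)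
  obtain q where q: "real_polynomial_function q" "\<And>x. x \<in> {a..b} \<Longrightarrow> \<bar>g x - q x\<bar> < d"
    using Stone_Weierstrass_real_polynomial_function[OF _ cont d] by auto
  obtain q' where "real_polynomial_function q'"
    and q': "\<And>x. (q has_real_derivative q' x) (at x)"
    using has_real_derivative_polynomial_function[OF q(1)] by blast
  have cq: "continuous_on A q" and cq': "continuous_on A q'" for A
    using q(1) \<open>real_polynomial_function q'\<close>
    by (auto simp: real_polynomial_function_eq intro: continuous_on_polymonial_function)
  define C where "C = \<bar>q a\<bar> + \<bar>q b\<bar> + integral {a..b} (\<lambda>t. \<bar>q' t\<bar>)"
  have bound: "\<bar>integral {a..b} (\<lambda>t. g t * sin (r * t))\<bar> \<le> C / r + e / 2" if r: "r > 0" for r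
  proof -
    have "((\<lambda>t. q t * sin (r * t) - q' t * cos (r * t) / r) has_integral
        - q b * cos (r * b) / r - (- q a * cos (r * a) / r)) {a..b}"
      using r \<open>a \<le> b\<close>
      by (intro integral_eq_increment[of "\<lambda>t. - q t * cos (r * t) / r"])
         (auto intro!: derivative_eq_intros q' simp: field_simps)
    moreover have iq': "(\<lambda>t. q' t * cos (r * t) / r) integrable_on {a..b}"
      by (intro integrable_continuous_interval continuous_intros cq') (use r in auto)
    ultimately have "((\<lambda>t. q t * sin (r * t) - q' t * cos (r * t) / r + q' t * cos (r * t) / r) has_integral
        - q b * cos (r * b) / r - (- q a * cos (r * a) / r) + integral {a..b} (\<lambda>t. q' t * cos (r * t) / r)) {a..b}"
      by (intro has_integral_add) (auto simp: has_integral_integral)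
    then have i1: "integral {a..b} (\<lambda>t. q t * sin (r * t)) =
        - q b * cos (r * b) / r - (- q a * cos (r * a) / r) + integral {a..b} (\<lambda>t. q' t * cos (r * t) / r)"
      by (simp add: integral_unique)
    have le: "\<bar>x * cos y / r\<bar> \<le> \<bar>x\<bar> / r" for x y
      using r mult_left_mono[OF abs_cos_le_one[of y], of "\<bar>x\<bar>"] by (simp add: abs_mult divide_right_mono)
    have "(\<lambda>t. \<bar>q' t\<bar> / r) integrable_on {a..b}"
      by (intro integrable_continuous_interval continuous_intros cq') (use r in auto)
    then have "\<bar>integral {a..b} (\<lambda>t. q' t * cos (r * t) / r)\<bar> \<le> integral {a..b} (\<lambda>t. \<bar>q' t\<bar> / r)"
      using iq' integral_norm_bound_integral[of "\<lambda>t. q' t * cos (r * t) / r" "{a..b}" "\<lambda>t. \<bar>q' t\<bar> / r"] le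
      by simp
    also have "\<dots> = integral {a..b} (\<lambda>t. \<bar>q' t\<bar>) / r" by simp
    finally have i2: "\<bar>integral {a..b} (\<lambda>t. q' t * cos (r * t) / r)\<bar> \<le> \<dots>" .
    have "\<bar>integral {a..b} (\<lambda>t. q t * sin (r * t))\<bar> \<le> \<bar>q b\<bar> / r + \<bar>q a\<bar> / r + integral {a..b} (\<lambda>t. \<bar>q' t\<bar>) / r"
    proof -
      have "integral {a..b} (\<lambda>t. q t * sin (r * t)) =
          q a * cos (r * a) / r - q b * cos (r * b) / r + integral {a..b} (\<lambda>t. q' t * cos (r * t) / r)"
        unfolding i1 by (simp only: minus_mult_left[symmetric] minus_divide_left[symmetric])
      then show ?thesis
        using i2 le[of "q b" "r * b"] le[of "q a" "r * a"] by linarith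
    qed
    then have i3: "\<bar>integral {a..b} (\<lambda>t. q t * sin (r * t))\<bar> \<le> C / r"
      by (simp add: C_def add_divide_distrib)
    have i4: "(\<lambda>t. (g t - q t) * sin (r * t)) integrable_on {a..b}"
      by (intro integrable_continuous_interval continuous_intros cq cont)
    have "\<bar>integral {a..b} (\<lambda>t. (g t - q t) * sin (r * t))\<bar> \<le> integral {a..b} (\<lambda>t. d)"
    proof -
      have "\<bar>(g t - q t) * sin (r * t)\<bar> \<le> d" if "t \<in> {a..b}" for t
      proof -
        have "\<bar>g t - q t\<bar> * \<bar>sin (r * t)\<bar> \<le> d * 1"
          using q(2)[OF that] d by (intro mult_mono) auto
        then show ?thesis by (simp add: abs_mult)
      qed
      then show ?thesis
        using integral_norm_bound_integral[of "\<lambda>t. (g t - q t) * sin (r * t)" "{a..b}" "\<lambda>t. d", OF i4]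
          integrable_const_ivl[of d a b] by (simp only: real_norm_def)
    qed
    also have "\<dots> = d * (b - a)" using \<open>a \<le> b\<close> by simp
    also have "\<dots> \<le> d * (b - a + 1)" using d by simp
    also have "\<dots> = e / 2" using w by (simp add: d_def flip: w_def)
    finally have i5: "\<bar>integral {a..b} (\<lambda>t. (g t - q t) * sin (r * t))\<bar> \<le> e / 2" .
    have i6: "(\<lambda>t. q t * sin (r * t)) integrable_on {a..b}"
      by (intro integrable_continuous_interval continuous_intros cq)
    have "integral {a..b} (\<lambda>t. g t * sin (r * t)) =
        integral {a..b} (\<lambda>t. (g t - q t) * sin (r * t) + q t * sin (r * t))"
      by (simp add: algebra_simps)
    also have "\<dots> = integral {a..b} (\<lambda>t. (g t - q t) * sin (r * t)) + integral {a..b} (\<lambda>t. q t * sin (r * t))"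
      by (rule integral_add[OF i4 i6])
    finally show ?thesis using i3 i5 by linarith
  qed
  have "((\<lambda>r. C / r + e / 2) \<longlongrightarrow> 0 + e / 2) at_top"
    by (intro tendsto_add tendsto_const
        tendsto_divide_0[OF tendsto_const filterlim_at_top_imp_at_infinity[OF filterlim_ident]])
  then have "\<forall>\<^sub>F r in at_top. C / r + e / 2 < e"
    using \<open>e > 0\<close> order_tendstoD(2)[of _ "e/2" at_top e] by simp
  then show "\<forall>\<^sub>F r in at_top. dist (integral {a..b} (\<lambda>t. g t * sin (r * t))) 0 < e"
    using eventually_gt_at_top[of 0]
    by eventually_elim (use bound in force)
qed

lemma eventually_nonzero_at_simple_zero:
  fixes s :: "real \<Rightarrow> real"
  assumes "(s has_real_derivative S) (at c)" "s c = 0" "S \<noteq> 0"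
  shows "\<forall>\<^sub>F x in at c. s x \<noteq> 0"
proof -
  have "((\<lambda>x. s x / (x - c)) \<longlongrightarrow> S) (at c)"
    using assms by (simp add: has_field_derivative_iff)
  then have "\<forall>\<^sub>F x in at c. s x / (x - c) \<noteq> 0" by (rule tendsto_imp_eventually_ne) fact
  then show ?thesis by (rule eventually_mono) auto
qed

text \<open>A Dirichlet kernel for the odd frequencies. Its denominator is \<open>sin t\<close> and not \<open>sin (t/2)\<close>, which
suits functions that change sign under a shift by \<open>pi\<close>.\<close>
lemma sum_odd_cosines: "sin t * (\<Sum>k<N. cos ((2 * real k + 1) * t)) = sin (2 * real N * t) / 2"
proof (induction N)
  case 0
  show ?case by simp
next
  case (Suc N)
  have "2 * (sin t * cos y) = sin (y + t) - sin (y - t)" for y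
    by (simp add: sin_add sin_diff)
  then have "2 * (sin t * cos ((2 * real N + 1) * t)) = sin ((2 * real N + 1) * t + t) - sin ((2 * real N + 1) * t - t)" .
  also have "(2 * real N + 1) * t + t = 2 * real (Suc N) * t" by (simp add: algebra_simps)
  also have "(2 * real N + 1) * t - t = 2 * real N * t" by (simp add: algebra_simps)
  finally have "sin t * cos ((2 * real N + 1) * t) = sin (2 * real (Suc N) * t) / 2 - sin (2 * real N * t) / 2"
    by linarith
  then show ?case unfolding sum.lessThan_Suc distrib_left Suc.IH by linarith
qed

text \<open>The partial sum at \<open>x\<close> is the integral of \<open>f (x + t)\<close> against the kernel above. The cosine is
reproduced exactly by every nonempty partial sum, so the error is the integral of
\<open>F t = f (x + t) - f x cos t\<close> against the kernel. The function \<open>F\<close> vanishes at \<open>0\<close> and at \<open>pi\<close>, so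
\<open>F t / sin t\<close> extends continuously to \<open>[0, pi]\<close>, and the Riemann-Lebesgue lemma applies.\<close>
lemma antiperiodic_odd_fourier_series:
  fixes f f' :: "real \<Rightarrow> real"
  assumes der: "\<And>x. (f has_real_derivative f' x) (at x)"
    and anti: "\<And>x. f (x + pi) = - f x"
  defines "a \<equiv> \<lambda>n. 2 / pi * integral {0..pi} (\<lambda>t. f t * cos (real n * t))"
    and "b \<equiv> \<lambda>n. 2 / pi * integral {0..pi} (\<lambda>t. f t * sin (real n * t))"
  shows "(\<lambda>n. if odd n then a n * cos (real n * x) + b n * sin (real n * x) else 0) sums f x"
proof -
  have cf: "continuous_on A f" for A by (rule deriv_imp_continuous_on_UNIV[OF der])
  define m where "m k = 2 * real k + 1" for k :: nat
  have cm: "cos (m k * (y + pi)) = - cos (m k * y)" for k y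
  proof -
    have "m k * (y + pi) = (m k * y + pi) + 2 * pi * real k" by (simp add: m_def algebra_simps)
    then show ?thesis using cos.plus_of_nat[of "m k * y + pi" k] by (simp only: mult.commute) simp
  qed
  define F where "F t = f (x + t) - f x * cos t" for t
  define F' where "F' t = f' (x + t) + f x * sin t" for t
  have dF: "(F has_real_derivative F' t) (at t)" for t
  proof -
    have "((\<lambda>t. f (x + t)) has_real_derivative f' (x + t)) (at t)"
      using der[of "t + x"] DERIV_shift[of f _ t x] by (simp add: add.commute)
    then show ?thesis unfolding F_def F'_def by (auto intro!: derivative_eq_intros)
  qed
  have cF: "continuous_on A F" for A by (rule deriv_imp_continuous_on_UNIV[OF dF])
  define G where "G t = (if sin t = 0 then F' t / cos t else F t / sin t)" for t
  have "isCont G t" if "t \<in> {0..pi}" for t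
  proof (cases "sin t = 0")
    case True
    then have "t = 0 \<or> t = pi" using that sin_gt_zero[of t] by force
    then have Ft: "F t = 0" using anti[of x] by (auto simp: F_def)
    have c: "cos t \<noteq> 0" using True sin_zero_abs_cos_one by fastforce
    have "((\<lambda>y. F y / sin y) \<longlongrightarrow> F' t / cos t) (at t)"
      by (rule quotient_of_zeros_tendsto[OF dF DERIV_sin Ft True c])
    moreover have "\<forall>\<^sub>F y in at t. F y / sin y = G y"
      using eventually_nonzero_at_simple_zero[OF DERIV_sin True c]
      by (rule eventually_mono) (simp add: G_def)
    ultimately have "(G \<longlongrightarrow> F' t / cos t) (at t)" by (rule Lim_transform_eventually)
    then show ?thesis using True by (simp add: isCont_def G_def)
  next
    case False
    have "((\<lambda>y. F y / sin y) \<longlongrightarrow> F t / sin t) (at t)"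
      using DERIV_isCont[OF dF[of t]] False by (intro tendsto_divide) (auto simp: isCont_def intro: tendsto_intros)
    moreover have "\<forall>\<^sub>F y in at t. sin y \<noteq> 0"
      by (rule tendsto_imp_eventually_ne[OF _ False]) (intro tendsto_intros)
    then have "\<forall>\<^sub>F y in at t. F y / sin y = G y"
      by (rule eventually_mono) (simp add: G_def)
    ultimately have "(G \<longlongrightarrow> F t / sin t) (at t)" by (rule Lim_transform_eventually)
    then show ?thesis using False by (simp add: isCont_def G_def)
  qed
  then have cG: "continuous_on {0..pi} G" by (simp add: continuous_at_imp_continuous_on)
  have "(\<lambda>N. integral {0..pi} (\<lambda>t. G t * sin (2 * real N * t))) \<longlonglongrightarrow> 0"
    by (rule filterlim_compose[OF riemann_lebesgue_sin[OF cG]])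
       (auto intro!: filterlim_tendsto_pos_mult_at_top[OF tendsto_const] filterlim_real_sequentially)
  moreover have "integral {0..pi} (\<lambda>t. G t * sin (2 * real N * t)) =
      2 * integral {0..pi} (\<lambda>t. F t * (\<Sum>k<N. cos (m k * t)))" for N
  proof -
    have "integral {0..pi} (\<lambda>t. G t * sin (2 * real N * t)) =
        integral {0..pi} (\<lambda>t. 2 * (F t * (\<Sum>k<N. cos (m k * t))))"
    proof (rule integral_spike[of "{0, pi}"])
      fix t assume "t \<in> {0..pi} - {0, pi}"
      then have "sin t > 0" by (intro sin_gt_zero) auto
      then show "2 * (F t * (\<Sum>k<N. cos (m k * t))) = G t * sin (2 * real N * t)"
        using sum_odd_cosines[of t N] by (simp add: G_def m_def field_simps)
    qed auto
    then show ?thesis by simp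
  qed
  ultimately have lim1: "(\<lambda>N. 2 * integral {0..pi} (\<lambda>t. F t * (\<Sum>k<N. cos (m k * t)))) \<longlonglongrightarrow> 0"
    by simp
  define c where "c k = a (2 * k + 1) * cos (m k * x) + b (2 * k + 1) * sin (m k * x)" for k
  have c: "c k = 2 / pi * integral {0..pi} (\<lambda>t. f (x + t) * cos (m k * t))" for k
  proof -
    have rm: "real (2 * k + 1) = m k" by (simp add: m_def)
    have "((\<lambda>t. cos (m k * x) * (f t * cos (m k * t)) + sin (m k * x) * (f t * sin (m k * t))) has_integral
       cos (m k * x) * integral {0..pi} (\<lambda>t. f t * cos (m k * t)) +
       sin (m k * x) * integral {0..pi} (\<lambda>t. f t * sin (m k * t))) {0..pi}"
      by (intro has_integral_add has_integral_mult_right integrable_integral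
          integrable_continuous_interval continuous_intros cf)
    moreover have "cos (m k * x) * (f t * cos (m k * t)) + sin (m k * x) * (f t * sin (m k * t)) =
        f t * cos (m k * (t - x))" for t
      by (simp add: right_diff_distrib cos_diff algebra_simps)
    ultimately have "c k = 2 / pi * integral {0..pi} (\<lambda>t. f t * cos (m k * (t - x)))"
      unfolding c_def a_def b_def rm by (simp add: integral_unique distrib_left algebra_simps)
    also have "integral {0..pi} (\<lambda>t. f t * cos (m k * (t - x))) =
        integral {x..x+pi} (\<lambda>t. f t * cos (m k * (t - x)))"
    proof (rule integral_over_period[symmetric])
      show "continuous_on UNIV (\<lambda>t. f t * cos (m k * (t - x)))" by (intro continuous_intros cf)
      show "f (t + pi) * cos (m k * (t + pi - x)) = f t * cos (m k * (t - x))" for t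
        using cm[of k "t - x"] anti[of t] by (simp add: algebra_simps)
    qed simp
    also have "\<dots> = integral {0..pi} (\<lambda>t. f (x + t) * cos (m k * t))"
      using integral_shift_Icc_real[of 0 pi "\<lambda>t. f t * cos (m k * (t - x))" x]
      by (simp add: o_def add.commute)
    finally show ?thesis .
  qed
  have orth: "integral {0..pi} (\<lambda>t. cos t * cos (m k * t)) = (if k = 0 then pi / 2 else 0)" for k
  proof -
    define r where "r = (if k = 0 then pi / 2 else 0)"
    define P where "P t = (if k = 0 then t / 2 else sin (2 * real k * t) / (4 * real k))
        + sin (2 * real (k + 1) * t) / (4 * real (k + 1))" for t
    have "((\<lambda>t. cos t * cos (m k * t)) has_integral P pi - P 0) {0..pi}"
    proof (rule integral_eq_increment)
      fix t
      have e1: "cos (2 * real k * t) = cos (m k * t) * cos t + sin (m k * t) * sin t"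
        by (simp add: m_def cos_diff[symmetric] algebra_simps)
      have e2: "cos (2 * real (k + 1) * t) = cos (m k * t) * cos t - sin (m k * t) * sin t"
        by (simp add: m_def cos_add[symmetric] algebra_simps)
      have "(P has_real_derivative cos (2 * real k * t) / 2 + cos (2 * real (k + 1) * t) / 2) (at t)"
      proof -
        have sj: "((\<lambda>t. sin (2 * real j * t) / (4 * real j)) has_real_derivative cos (2 * real j * t) / 2) (at t)"
          if "j > 0" for j
          using that by (auto intro!: derivative_eq_intros)
        show ?thesis
        proof (cases "k = 0")
          case True
          then show ?thesis using sj[of 1] unfolding P_def by (auto intro!: derivative_eq_intros)
        next
          case False
          then show ?thesis using DERIV_add[OF sj[of k] sj[of "k + 1"]] unfolding P_def by simp
        qed
      qed
      then show "(P has_real_derivative cos t * cos (m k * t)) (at t)"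
        unfolding e1 e2 by (simp add: field_simps)
    qed simp
    moreover have "P pi - P 0 = r"
    proof -
      have "sin (2 * real j * pi) = 0" for j
        using sin_npi[of "2 * j"] by simp
      from this[of k] this[of "k + 1"] show ?thesis unfolding P_def r_def by simp
    qed
    ultimately show ?thesis unfolding r_def by (simp add: integral_unique)
  qed
  have sumc: "(\<Sum>k<N. c k) = 2 / pi * integral {0..pi} (\<lambda>t. F t * (\<Sum>k<N. cos (m k * t))) + f x"
    if "N > 0" for N
  proof -
    have fi: "(\<lambda>t. F t * cos (m k * t)) integrable_on {0..pi}"
             "(\<lambda>t. f x * (cos t * cos (m k * t))) integrable_on {0..pi}" for k
      by (intro integrable_continuous_interval continuous_intros cF)+
    have "(\<Sum>k<N. c k) = (\<Sum>k<N. 2 / pi * (integral {0..pi} (\<lambda>t. F t * cos (m k * t)) + 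
        f x * (if k = 0 then pi / 2 else 0)))"
    proof (rule sum.cong)
      fix k assume "k \<in> {..<N}"
      have "integral {0..pi} (\<lambda>t. f (x + t) * cos (m k * t)) =
         integral {0..pi} (\<lambda>t. F t * cos (m k * t) + f x * (cos t * cos (m k * t)))"
        by (simp add: F_def algebra_simps)
      also have "\<dots> = integral {0..pi} (\<lambda>t. F t * cos (m k * t)) + f x * (if k = 0 then pi / 2 else 0)"
        unfolding integral_add[OF fi] by (simp add: orth)
      finally show "c k = 2 / pi * (integral {0..pi} (\<lambda>t. F t * cos (m k * t)) + 
        f x * (if k = 0 then pi / 2 else 0))" by (simp add: c)
    qed simp
    also have "\<dots> = 2 / pi * (\<Sum>k<N. integral {0..pi} (\<lambda>t. F t * cos (m k * t)))
        + 2 / pi * f x * (\<Sum>k<N. if k = 0 then pi / 2 else 0)"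
      by (simp only: sum_distrib_left sum.distrib distrib_left mult.assoc)
    also have "(\<Sum>k<N. if k = 0 then pi / 2 else 0) = pi / 2" using that by simp
    also have "(\<Sum>k<N. integral {0..pi} (\<lambda>t. F t * cos (m k * t))) =
        integral {0..pi} (\<lambda>t. F t * (\<Sum>k<N. cos (m k * t)))"
      by (subst integral_sum[symmetric]) (auto simp: fi sum_distrib_left)
    finally show ?thesis by simp
  qed
  have "(\<lambda>N. 1 / pi * (2 * integral {0..pi} (\<lambda>t. F t * (\<Sum>k<N. cos (m k * t)))) + f x) \<longlonglongrightarrow> 1 / pi * 0 + f x"
    by (intro tendsto_intros lim1)
  moreover have "\<forall>\<^sub>F N in sequentially. 1 / pi * (2 * integral {0..pi} (\<lambda>t. F t * (\<Sum>k<N. cos (m k * t)))) + f x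
      = (\<Sum>k<N. c k)"
    using eventually_gt_at_top[of 0] by eventually_elim (simp add: sumc)
  ultimately have "c sums f x"
    unfolding sums_def using Lim_transform_eventually by fastforce
  then have "(\<lambda>n. if even n then 0 else c ((n - 1) div 2)) sums (f x + 0)"
    using sums_if[OF _ sums_zero, of c "f x"] by simp
  moreover have "(if even n then 0 else c ((n - 1) div 2)) =
      (if odd n then a n * cos (real n * x) + b n * sin (real n * x) else 0)" for n
  proof (cases "odd n")
    case True
    then obtain k where "n = 2 * k + 1" by (rule oddE)
    then show ?thesis by (simp add: c_def m_def algebra_simps)
  qed simp
  ultimately show ?thesis by simp
qed

section \<open>The inequality in terms of the support function\<close>

lemma has_vector_derivative_vector2:
  assumes "(f has_real_derivative f') (at t)" "(g has_real_derivative g') (at t)"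
  shows "((\<lambda>t. vector [f t, g t] :: real^2) has_vector_derivative vector [f', g']) (at t)"
proof -
  have v: "vector [a, b] = a *\<^sub>R (vector [1, 0] :: real^2) + b *\<^sub>R vector [0, 1]" for a b :: real
    by (simp add: vec_eq_iff forall_2)
  show ?thesis
    unfolding v[of "f _" "g _"] v[of f' g'] by (auto intro!: derivative_eq_intros assms)
qed

lemma cross2_vector [simp]: "cross2 (vector [a, b]) (vector [c, d]) = a * d - b * c"
  by (simp add: cross2_def)

lemma integral_by_parts_periodic:
  fixes f f1 f2 :: "real \<Rightarrow> real"
  assumes der: "\<And>x. (f has_real_derivative f1 x) (at x)"
    and der1: "\<And>x. (f1 has_real_derivative f2 x) (at x)"
    and bdry: "f pi * f1 pi = f 0 * f1 0"
  shows "((\<lambda>x. f x * (f x + f2 x)) has_integral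
      integral {0..pi} (\<lambda>x. (f x)\<^sup>2) - integral {0..pi} (\<lambda>x. (f1 x)\<^sup>2)) {0..pi}"
proof -
  have ints: "(\<lambda>x. (f1 x)\<^sup>2) integrable_on {0..pi}" "(\<lambda>x. (f x)\<^sup>2) integrable_on {0..pi}"
    by (intro integrable_continuous_interval continuous_on_power
        deriv_imp_continuous_on_UNIV[OF der] deriv_imp_continuous_on_UNIV[OF der1])+
  have "((\<lambda>x. (f1 x)\<^sup>2 + f x * f2 x) has_integral f pi * f1 pi - f 0 * f1 0) {0..pi}"
    by (rule integral_eq_increment)
       (auto intro!: derivative_eq_intros der der1 simp: power2_eq_square)
  then have "((\<lambda>x. (f x)\<^sup>2 - (f1 x)\<^sup>2 + ((f1 x)\<^sup>2 + f x * f2 x)) has_integral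
      integral {0..pi} (\<lambda>x. (f x)\<^sup>2) - integral {0..pi} (\<lambda>x. (f1 x)\<^sup>2) + (f pi * f1 pi - f 0 * f1 0)) {0..pi}"
    by (intro has_integral_add has_integral_diff integrable_integral ints)
  moreover have "(f x)\<^sup>2 - (f1 x)\<^sup>2 + ((f1 x)\<^sup>2 + f x * f2 x) = f x * (f x + f2 x)" for x
    by (simp add: power2_eq_square algebra_simps)
  ultimately show ?thesis using bdry by simp
qed

text \<open>In the midpoint of the points with normal angles \<open>\<theta>\<close> and \<open>\<theta> + pi\<close> the even part of the support
function cancels, because the two normals are opposite. Thus the Wigner caustic is the curve
with support function \<open>h\<close>.\<close>
lemma wigner_caustic_area_eq:
  assumes der: "\<And>x. (p has_real_derivative p1 x) (at x)"
    and der1: "\<And>x. (p1 has_real_derivative p2 x) (at x)"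
    and per: "\<And>x. p (x + 2 * pi) = p x"
  defines "h \<equiv> \<lambda>x. (p x - p (x + pi)) / 2"
    and "h1 \<equiv> \<lambda>x. (p1 x - p1 (x + pi)) / 2"
    and "h2 \<equiv> \<lambda>x. (p2 x - p2 (x + pi)) / 2"
  shows "wigner_caustic_area p = 1 / 2 * integral {0..pi} (\<lambda>x. h x * (h x + h2 x))"
proof -
  have dp: "deriv p x = p1 x" for x using der by (rule DERIV_imp_deriv)
  have dh: "(h has_real_derivative h1 x) (at x)" "(h1 has_real_derivative h2 x) (at x)" for x
    unfolding h_def h1_def h2_def
    by (auto intro!: derivative_eq_intros der der1 deriv_shift[OF der] deriv_shift[OF der1])
  have w: "wigner_caustic p = (\<lambda>x. vector [h x * cos x - h1 x * sin x, h x * sin x + h1 x * cos x])"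
    unfolding wigner_caustic_def[abs_def] support_param_def dp h_def h1_def
    by (intro ext) (simp add: vec_eq_iff forall_2 algebra_simps diff_divide_distrib)
  have "(wigner_caustic p has_vector_derivative
      vector [- (h x + h2 x) * sin x, (h x + h2 x) * cos x]) (at x)" for x
    unfolding w by (intro has_vector_derivative_vector2)
      (auto intro!: derivative_eq_intros dh simp: algebra_simps)
  then have vd: "vderiv (wigner_caustic p) x = vector [- (h x + h2 x) * sin x, (h x + h2 x) * cos x]" for x
    unfolding vderiv_def by (rule vector_derivative_at)
  have "cross2 (wigner_caustic p x) (vderiv (wigner_caustic p) x) = h x * (h x + h2 x)" for x
  proof -
    have "cross2 (wigner_caustic p x) (vderiv (wigner_caustic p) x) =
        (h x * (h x + h2 x)) * (cos x * cos x + sin x * sin x)"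
      unfolding vd unfolding w cross2_vector
      by (simp add: algebra_simps del: sin_cos_squared_add3)
    then show ?thesis by (simp only: sin_cos_squared_add3 mult_1_right)
  qed
  then show ?thesis by (simp add: wigner_caustic_area_def)
qed

text \<open>Here \<open>m\<close> and \<open>h\<close> are the even and the odd part of \<open>p\<close>, and \<open>e\<close> is \<open>m\<close> without its mean. The letters
\<open>E\<close>, \<open>E1\<close>, \<open>H\<close>, \<open>H1\<close> stand for the integrals of the squares of \<open>e\<close>, \<open>h\<close> and their derivatives over half
a period. In these terms the two sides are \<open>4 pi (E1 - E)\<close> and \<open>4 pi (3 E)\<close>.\<close>
theorem isoperimetric_wigner_inequality:
  fixes p p1 p2 :: "real \<Rightarrow> real"
  assumes der: "\<And>x. (p has_real_derivative p1 x) (at x)"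
    and der1: "\<And>x. (p1 has_real_derivative p2 x) (at x)"
    and cont: "continuous_on UNIV p2"
    and per: "\<And>x. p (x + 2 * pi) = p x"
  defines "L \<equiv> integral {0..2*pi} p"
    and "A \<equiv> 1 / 2 * integral {0..2*pi} (\<lambda>x. p x * (p x + p2 x))"
  defines "lhs \<equiv> L\<^sup>2 - 4 * pi * A - 8 * pi * \<bar>wigner_caustic_area p\<bar>"
    and "rhs \<equiv> 6 * pi * (d2 p (wigner_type_support L p))\<^sup>2"
  shows "rhs \<le> lhs"
    and "lhs = rhs \<longleftrightarrow>
      (\<exists>C A B. \<forall>x. (p x + p (x + pi)) / 2 = C + A * cos (2 * x) + B * sin (2 * x))"
proof -
  define h where "h \<equiv> \<lambda>x. (p x - p (x + pi)) / 2"
  define h1 where "h1 \<equiv> \<lambda>x. (p1 x - p1 (x + pi)) / 2"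
  define h2 where "h2 \<equiv> \<lambda>x. (p2 x - p2 (x + pi)) / 2"
  define m where "m x = (p x + p (x + pi)) / 2" for x
  define m1 where "m1 x = (p1 x + p1 (x + pi)) / 2" for x
  define m2 where "m2 x = (p2 x + p2 (x + pi)) / 2" for x
  define e where "e x = m x - L / (2 * pi)" for x
  have per': "p (x + pi + pi) = p x" for x using per[of x] by (simp add: algebra_simps)
  have per1: "p1 (x + pi + pi) = p1 x" for x
    using deriv_shift[OF der, of "2 * pi" x] der[of x] unfolding per
    by (simp add: algebra_simps DERIV_unique)
  have per2: "p2 (x + pi + pi) = p2 x" for x
  proof -
    have "p1 (x + 2 * pi) = p1 x" for x using per1[of x] by (simp add: algebra_simps)
    then show ?thesis
      using deriv_shift[OF der1, of "2 * pi" x] der1[of x] by (simp add: algebra_simps DERIV_unique)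
  qed
  have pers: "p (x + pi * 2) = p x" "p1 (x + pi * 2) = p1 x" "p2 (x + pi * 2) = p2 x" for x
    using per'[of x] per1[of x] per2[of x] by (simp_all add: algebra_simps)
  note sh = deriv_shift[OF der] deriv_shift[OF der1]
  have dh: "(h has_real_derivative h1 x) (at x)" and dh1: "(h1 has_real_derivative h2 x) (at x)" 
    and dm: "(m has_real_derivative m1 x) (at x)" and dm1: "(m1 has_real_derivative m2 x) (at x)"
    and de: "(e has_real_derivative m1 x) (at x)" for x
    unfolding h_def h1_def h2_def m_def m1_def m2_def e_def
    by (auto intro!: derivative_eq_intros der der1 sh)
  have cp2': "continuous_on UNIV (\<lambda>x. p2 (x + pi))"
    by (intro continuous_on_compose2[OF cont] continuous_intros) auto
  have cm2: "continuous_on UNIV m2"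
    unfolding m2_def by (intro continuous_intros cont cp2') simp
  note c = deriv_imp_continuous_on_UNIV
  have mper: "m (x + pi) = m x" "e (x + pi) = e x" "m1 (x + pi) = m1 x" "m2 (x + pi) = m2 x"
    and hper: "h (x + pi) = - h x" "h1 (x + pi) = - h1 x" "h2 (x + pi) = - h2 x" for x
    by (simp_all add: m_def e_def m1_def m2_def h_def h1_def h2_def pers field_simps)
  have im: "m integrable_on {0..pi}" "(\<lambda>x. (e x)\<^sup>2) integrable_on {0..pi}" "e integrable_on {0..pi}"
    by (intro integrable_continuous_interval continuous_on_power c[OF dm] c[OF de])+
  have Lm: "integral {0..pi} m = L / 2"
  proof -
    have "L = integral {0..pi} (\<lambda>x. 2 * m x)"
    proof -
      have "2 * m x = p x + p (x + pi)" for x by (simp add: m_def)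
      then show ?thesis unfolding L_def integral_fold_half_period[OF c[OF der]] by presburger
    qed
    then show ?thesis by simp
  qed
  then have "(m has_integral L / 2) {0..pi}" using im by (metis integrable_integral)
  then have "(e has_integral (L / 2 - (pi - 0) *\<^sub>R (L / (2 * pi)))) {0..pi}"
    unfolding e_def using has_integral_const_real[of "L / (2 * pi)" 0 pi]
    by (intro has_integral_diff) simp_all
  then have mean: "(e has_integral 0) {0..pi}" by simp
  define E where "E = integral {0..pi} (\<lambda>x. (e x)\<^sup>2)"
  define E1 where "E1 = integral {0..pi} (\<lambda>x. (m1 x)\<^sup>2)"
  define H where "H = integral {0..pi} (\<lambda>x. (h x)\<^sup>2)"
  define H1 where "H1 = integral {0..pi} (\<lambda>x. (h1 x)\<^sup>2)"
  have M: "integral {0..pi} (\<lambda>x. (m x)\<^sup>2) = E + L\<^sup>2 / (4 * pi)"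
  proof -
    have "((\<lambda>x. (e x)\<^sup>2 + 2 * (L / (2 * pi)) * e x + (L / (2 * pi))\<^sup>2) has_integral
        E + 2 * (L / (2 * pi)) * 0 + (pi - 0) *\<^sub>R (L / (2 * pi))\<^sup>2) {0..pi}"
      unfolding E_def using has_integral_const_real[of "(L / (2 * pi))\<^sup>2" 0 pi]
      by (intro has_integral_add has_integral_mult_right mean integrable_integral im) simp_all
    moreover have "(e x)\<^sup>2 + 2 * (L / (2 * pi)) * e x + (L / (2 * pi))\<^sup>2 = (m x)\<^sup>2" for x
      unfolding e_def by (simp add: power2_eq_square algebra_simps)
    ultimately show ?thesis
      by (simp add: integral_unique power2_eq_square)
  qed
  have ihh: "((\<lambda>x. h x * (h x + h2 x)) has_integral H - H1) {0..pi}"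
    unfolding H_def H1_def
    by (rule integral_by_parts_periodic[OF dh dh1]) (use hper[of 0] in simp)
  have imm: "((\<lambda>x. m x * (m x + m2 x)) has_integral (E + L\<^sup>2 / (4 * pi)) - E1) {0..pi}"
    unfolding E1_def M[symmetric]
    by (rule integral_by_parts_periodic[OF dm dm1]) (use mper[of 0] in simp)
  have area: "A = (E + L\<^sup>2 / (4 * pi)) - E1 + (H - H1)"
  proof -
    have "integral {0..2*pi} (\<lambda>x. p x * (p x + p2 x)) =
        integral {0..pi} (\<lambda>x. 2 * (m x * (m x + m2 x) + h x * (h x + h2 x)))"
    proof -
      have "2 * (m x * (m x + m2 x) + h x * (h x + h2 x)) =
          p x * (p x + p2 x) + p (x + pi) * (p (x + pi) + p2 (x + pi))" for x
        by (simp add: m_def m2_def h_def h2_def field_simps)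
      moreover have "continuous_on UNIV (\<lambda>x. p x * (p x + p2 x))"
        by (intro continuous_intros c[OF der] cont)
      ultimately show ?thesis using integral_fold_half_period by presburger
    qed
    also have "\<dots> = 2 * ((E + L\<^sup>2 / (4 * pi)) - E1 + (H - H1))"
      by (intro integral_unique has_integral_mult_right has_integral_add imm ihh)
    finally show ?thesis by (simp add: A_def)
  qed
  have wig: "wigner_caustic_area p = (H - H1) / 2"
    using wigner_caustic_area_eq[OF der der1 per] integral_unique[OF ihh]
    by (simp add: h_def h2_def)
  have "H \<le> H1"
    unfolding H_def H1_def
    by (rule wirtinger_antiperiodic[OF dh c[OF dh1] hper(1)])
  then have lhs: "lhs = 4 * pi * (E1 - E)"
    unfolding lhs_def area wig by (simp add: field_simps power2_eq_square)
  have "(d2 p (wigner_type_support L p))\<^sup>2 = 2 * E"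
  proof -
    have "\<bar>p x - wigner_type_support L p x\<bar>\<^sup>2 = (e x)\<^sup>2" for x
    proof -
      have "p x - wigner_type_support L p x = e x"
        by (simp add: wigner_type_support_def e_def m_def field_simps)
      then show ?thesis by simp
    qed
    then have "(d2 p (wigner_type_support L p))\<^sup>2 = (sqrt (integral {0..2*pi} (\<lambda>x. (e x)\<^sup>2)))\<^sup>2"
      unfolding d2_def by presburger
    also have "integral {0..2*pi} (\<lambda>x. (e x)\<^sup>2) = 2 * E"
      by (subst integral_fold_half_period) (auto intro!: continuous_on_power c[OF de] simp: mper E_def)
    also have "(sqrt (2 * E))\<^sup>2 = 2 * E"
      unfolding E_def using integral_nonneg[OF im(2)] by simp
    finally show ?thesis .
  qed
  then have rhs: "rhs = 4 * pi * (3 * E)" by (simp add: rhs_def)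
  note W = wirtinger_period_pi[OF de dm1 cm2 mper(2) integral_unique[OF mean], folded E_def E1_def]
  show "rhs \<le> lhs" unfolding lhs rhs using W(1) by simp
  have "lhs = rhs \<longleftrightarrow> E1 = 4 * E" unfolding lhs rhs by auto
  also have "\<dots> \<longleftrightarrow> (\<exists>A B. \<forall>x. e x = A * cos (2 * x) + B * sin (2 * x))" by (rule W(2))
  also have "\<dots> \<longleftrightarrow> (\<exists>C A B. \<forall>x. m x = C + A * cos (2 * x) + B * sin (2 * x))"
  proof
    assume "\<exists>A B. \<forall>x. e x = A * cos (2 * x) + B * sin (2 * x)"
    then obtain A B where "\<And>x. e x = A * cos (2 * x) + B * sin (2 * x)" by blast
    then have "\<forall>x. m x = L / (2 * pi) + A * cos (2 * x) + B * sin (2 * x)"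
      unfolding e_def by (simp add: algebra_simps)
    then show "\<exists>C A B. \<forall>x. m x = C + A * cos (2 * x) + B * sin (2 * x)" by blast
  next
    assume "\<exists>C A B. \<forall>x. m x = C + A * cos (2 * x) + B * sin (2 * x)"
    then obtain C A B where mm: "\<And>x. m x = C + A * cos (2 * x) + B * sin (2 * x)" by blast
    \<comment> \<open>a primitive of the even part, to read off its mean value\<close>
    define P where "P x = C * x + A * sin (2 * x) / 2 - B * cos (2 * x) / 2" for x
    have "(m has_integral P pi - P 0) {0..pi}"
    proof (rule integral_eq_increment)
      show "(P has_real_derivative m x) (at x)" for x
        unfolding P_def mm by (auto intro!: derivative_eq_intros)
    qed simp
    then have "C = L / (2 * pi)"
      using Lm by (simp add: P_def integral_unique field_simps)
    then have "\<forall>x. e x = A * cos (2 * x) + B * sin (2 * x)" by (simp add: e_def mm)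
    then show "\<exists>A B. \<forall>x. e x = A * cos (2 * x) + B * sin (2 * x)" by blast
  qed
  finally show "lhs = rhs \<longleftrightarrow>
      (\<exists>C A B. \<forall>x. (p x + p (x + pi)) / 2 = C + A * cos (2 * x) + B * sin (2 * x))"
    by (simp only: m_def)
qed

text \<open>Shifting by \<open>pi\<close> negates every term of the series, so a sum of this kind only describes the odd part
of \<open>p\<close>, and the convergence theorem provides it for the odd part of any
differentiable \<open>p\<close>. The coefficients with index
\<open>0\<close> and \<open>2\<close> are free for the even part, as the series runs over odd indices.\<close>
lemma even_part_second_harmonic_iff_fourier_series:
  fixes p p1 :: "real \<Rightarrow> real"
  assumes der: "\<And>x. (p has_real_derivative p1 x) (at x)"
    and per: "\<And>x. p (x + 2 * pi) = p x"
  shows "(\<exists>C A B. \<forall>x. (p x + p (x + pi)) / 2 = C + A * cos (2 * x) + B * sin (2 * x)) \<longleftrightarrow>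
    (\<exists>a b :: nat \<Rightarrow> real. \<forall>\<theta>.
       (\<lambda>n. if odd n then a n * cos (real n * \<theta>) + b n * sin (real n * \<theta>) else 0)
         sums (p \<theta> - (a 0 + a 2 * cos (2 * \<theta>) + b 2 * sin (2 * \<theta>))))" (is "?E \<longleftrightarrow> ?S")
proof
  assume ?E
  then obtain C A B where E: "\<And>x. (p x + p (x + pi)) / 2 = C + A * cos (2 * x) + B * sin (2 * x)"
    by blast
  define h where "h x = (p x - p (x + pi)) / 2" for x
  have dh: "(h has_real_derivative (p1 x - p1 (x + pi)) / 2) (at x)" for x
    unfolding h_def by (auto intro!: derivative_eq_intros der deriv_shift[OF der])
  have hper: "h (x + pi) = - h x" for x
    using per[of x] by (simp add: h_def algebra_simps minus_divide_left)
  define a where "a n = 2 / pi * integral {0..pi} (\<lambda>t. h t * cos (real n * t))" for n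
  define b where "b n = 2 / pi * integral {0..pi} (\<lambda>t. h t * sin (real n * t))" for n
  \<comment> \<open>the entries with index \<open>0\<close> and \<open>2\<close> do not occur in the series and carry the even part\<close>
  define a' where "a' = a(0 := C, 2 := A)"
  define b' where "b' = b(2 := B)"
  have "(\<lambda>n. if odd n then a' n * cos (real n * x) + b' n * sin (real n * x) else 0)
      sums (p x - (a' 0 + a' 2 * cos (2 * x) + b' 2 * sin (2 * x)))" for x
  proof -
    have "(\<lambda>n. if odd n then a' n * cos (real n * x) + b' n * sin (real n * x) else 0) =
        (\<lambda>n. if odd n then a n * cos (real n * x) + b n * sin (real n * x) else 0)"
      by (auto simp: a'_def b'_def)
    moreover have "p x - (a' 0 + a' 2 * cos (2 * x) + b' 2 * sin (2 * x)) = h x"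
      using E[of x] by (simp add: a'_def b'_def h_def field_simps)
    moreover have "(\<lambda>n. if odd n then a n * cos (real n * x) + b n * sin (real n * x) else 0) sums h x"
      unfolding a_def b_def by (rule antiperiodic_odd_fourier_series[OF dh hper])
    ultimately show ?thesis by simp
  qed
  then show ?S by blast
next
  assume ?S
  then obtain a b where S: "\<And>x. (\<lambda>n. if odd n then a n * cos (real n * x) + b n * sin (real n * x) else 0)
         sums (p x - (a 0 + a 2 * cos (2 * x) + b 2 * sin (2 * x)))" by blast
  have "(p x + p (x + pi)) / 2 = a 0 + a 2 * cos (2 * x) + b 2 * sin (2 * x)" for x
  proof -
    have "(if odd n then a n * cos (real n * (x + pi)) + b n * sin (real n * (x + pi)) else 0) =
       - (if odd n then a n * cos (real n * x) + b n * sin (real n * x) else 0)" for n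
    proof (cases "odd n")
      case True
      then obtain k where k: "n = 2 * k + 1" by (rule oddE)
      have "real n * (x + pi) = (real n * x + pi) + 2 * pi * real k" by (simp add: k algebra_simps)
      then have "cos (real n * (x + pi)) = - cos (real n * x)" "sin (real n * (x + pi)) = - sin (real n * x)"
        using cos.plus_of_nat[of "real n * x + pi" k] sin.plus_of_nat[of "real n * x + pi" k]
        by (simp_all only: mult.commute[of "2 * pi"]) simp_all
      then show ?thesis using True by simp
    qed simp
    then have "(\<lambda>n. - (if odd n then a n * cos (real n * x) + b n * sin (real n * x) else 0))
        sums (p (x + pi) - (a 0 + a 2 * cos (2 * (x + pi)) + b 2 * sin (2 * (x + pi))))"
      using S[of "x + pi"] by simp
    from sums_unique2[OF this sums_minus[OF S[of x]]]
    have "p (x + pi) - (a 0 + a 2 * cos (2 * (x + pi)) + b 2 * sin (2 * (x + pi))) =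
      - (p x - (a 0 + a 2 * cos (2 * x) + b 2 * sin (2 * x)))" .
    moreover have "cos (2 * (x + pi)) = cos (2 * x)" "sin (2 * (x + pi)) = sin (2 * x)"
      using cos_periodic[of "2 * x"] sin_periodic[of "2 * x"] by (simp_all only: distrib_left)
    ultimately show ?thesis by simp
  qed
  then show ?E by blast
qed

section \<open>Plane convex domains and area in polar form\<close>

lemma strictly_convex_domain_imp_convex:
  assumes "strictly_convex_domain K"
  shows "convex K"
proof (rule convexI)
  fix x y and u v :: real
  assume xy: "x \<in> K" "y \<in> K" and uv: "0 \<le> u" "0 \<le> v" "u + v = 1"
  show "u *\<^sub>R x + v *\<^sub>R y \<in> K"
  proof (cases "x = y \<or> u = 0 \<or> v = 0")
    case True
    then show ?thesis using xy uv by (auto simp flip: scaleR_left_distrib)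
  next
    case False
    have "u *\<^sub>R x + v *\<^sub>R y \<in> open_segment x y"
    proof -
      have u: "u = 1 - v" using uv by simp
      show ?thesis unfolding in_segment using False uv unfolding u
        by (intro conjI exI[of _ v]) auto
    qed
    moreover have "open_segment x y \<subseteq> interior K"
      using assms xy False closure_subset unfolding strictly_convex_domain_def by blast
    ultimately show ?thesis using interior_subset by blast
  qed
qed

text \<open>If \<open>K\<close> is unbounded, then it meets the complement of a large disc, which is connected and free of
frontier points, hence contained in \<open>K\<close>. The convex hull of that complement is the whole plane, which has empty frontier.\<close>
lemma bounded_of_bounded_frontier_convex:
  fixes K :: "(real^2) set"
  assumes "convex K" "bounded (frontier K)" "frontier K \<noteq> {}"
  shows "bounded K"
proof (rule ccontr)
  assume unb: "\<not> bounded K"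
  obtain R where R: "frontier K \<subseteq> cball 0 R" using bounded_subset_ballD[OF assms(2), of 0] ball_subset_cball by blast
  have conn: "connected (- cball (0::real^2) R)"
    by (rule connected_complement_bounded_convex) auto
  have "\<not> K \<subseteq> cball 0 R" using unb bounded_subset bounded_cball by blast
  then have "- cball 0 R \<inter> K \<noteq> {}" by blast
  then have sub: "- cball 0 R \<subseteq> K"
    using connected_Int_frontier[OF conn, of K] R by blast
  have "x \<in> K" for x
  proof -
    \<comment> \<open>large enough for \<open>x + v\<close> and \<open>x - v\<close> to lie outside the disc\<close>
    define v :: "real^2" where "v = (\<bar>R\<bar> + norm x + 1) *\<^sub>R axis 1 1"
    have nv: "norm v = \<bar>R\<bar> + norm x + 1" by (simp add: v_def norm_axis_1)
    have "norm (x + v) > R" "norm (x - v) > R"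
      using norm_triangle_ineq4[of "x + v" x] norm_triangle_ineq4[of x "x - v"] nv by simp_all
    then have "x + v \<in> K" "x - v \<in> K" using sub by auto
    then have "(1/2) *\<^sub>R (x + v) + (1/2) *\<^sub>R (x - v) \<in> K"
      using \<open>convex K\<close> by (intro convexD) auto
    moreover have "(1/2) *\<^sub>R (x + v) + (1/2) *\<^sub>R (x - v) = x"
      by (simp add: vec_eq_iff field_simps)
    ultimately show ?thesis by simp
  qed
  then have "K = UNIV" by auto
  then show False using assms(3) by simp
qed

lemma measure_cart_box2:
  assumes "a \<ge> 0" "b \<ge> 0"
  shows "measure lebesgue (box (vector [0, 0]) (vector [a, b]) :: (real^2) set) = a * b"
proof -
  have "measure lebesgue (box (vector [0, 0]) (vector [a, b]) :: (real^2) set) =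
      measure lborel (cbox (vector [0, 0]) (vector [a, b]) :: (real^2) set)"
    by (simp add: measure_lborel_box_eq measure_lborel_cbox_eq)
  also have "\<dots> = a * b"
    using assms by (subst content_cbox_cart) (auto simp: interval_ne_empty_cart forall_2 UNIV_2)
  finally show ?thesis .
qed

lemma mem_cart_box2: "v \<in> box (vector [0, 0]) (vector [a, b]) \<longleftrightarrow> 0 < v$1 \<and> v$1 < a \<and> 0 < v$2 \<and> v$2 < b"
  for v :: "real^2"
  by (auto simp: mem_box_cart forall_2)

text \<open>The map \<open>P (r, t) = z + r (c t - z)\<close> sends the open rectangle \<open>S\<close> bijectively onto the interior of \<open>K\<close>
without one ray, and its Jacobian is \<open>r g t\<close> with \<open>g t = cross2 (c t - z) (c1 t)\<close>. For a primitive \<open>G\<close>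
of \<open>g\<close> the map \<open>H (r, t) = (r\<^sup>2 / 2, G t)\<close> has the same Jacobian, and its image is a rectangle. Hence
both images have area \<open>1/2 G T\<close>; the second map takes the place of an iterated integral.\<close>
lemma area_enclosed_by_star_shaped_curve:
  fixes K :: "(real^2) set" and c c1 :: "real \<Rightarrow> real^2"
  assumes K: "convex K" "bounded K" and z: "z \<in> interior K" and fr: "frontier K = c ` {0..T}"
    and T: "0 < T" and der: "\<And>t. (c has_vector_derivative c1 t) (at t)"
    and cont: "continuous_on UNIV c1" and inj: "inj_on c {0<..<T}" and closed: "c T = c 0"
    and pos: "\<And>t. cross2 (c t - z) (c1 t) > 0"
  shows "measure lebesgue K = 1 / 2 * integral {0..T} (\<lambda>t. cross2 (c t - z) (c1 t))"
proof -
  define g where "g t = cross2 (c t - z) (c1 t)" for t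
  have cc: "continuous_on UNIV c"
    by (intro continuous_at_imp_continuous_on ballI has_vector_derivative_continuous[OF der])
  have cg: "continuous_on UNIV g"
    unfolding g_def cross2_def by (intro continuous_intros cont cc)
  obtain G0 where G0: "\<And>t. (G0 has_real_derivative g t) (at t)"
    using antiderivative_on_UNIV[OF cg] by blast
  define G where "G t = G0 t - G0 0" for t
  have dG: "(G has_real_derivative g t) (at t)" for t
    unfolding G_def by (auto intro!: derivative_eq_intros G0)
  have Gint: "integral {0..T} g = G T"
    using integral_eq_increment[of G g 0 T, OF dG] T by (simp add: integral_unique G_def)
  have Gmono: "G s < G t" if "s < t" for s t
    using DERIV_pos_imp_increasing[OF that, of G] dG pos unfolding g_def by blast
  define S :: "(real^2) set" where "S = box (vector [0, 0]) (vector [1, T])"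
  have memS: "v \<in> S \<longleftrightarrow> 0 < v$1 \<and> v$1 < 1 \<and> 0 < v$2 \<and> v$2 < T" for v
    unfolding S_def by (rule mem_cart_box2)
  define P where "P v = z + (v$1) *\<^sub>R (c (v$2) - z)" for v :: "real^2"
  define P' where "P' v h = (h$1) *\<^sub>R (c (v$2) - z) + (v$1) *\<^sub>R ((h$2) *\<^sub>R c1 (v$2))" for v h :: "real^2"
  define H :: "real^2 \<Rightarrow> real^2" where "H v = ((v$1)\<^sup>2 / 2) *\<^sub>R axis 1 1 + G (v$2) *\<^sub>R axis 2 1" for v
  define H' :: "real^2 \<Rightarrow> real^2 \<Rightarrow> real^2"
    where "H' v h = ((v$1) * (h$1)) *\<^sub>R axis 1 1 + (g (v$2) * (h$2)) *\<^sub>R axis 2 1" for v h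
  have nth: "((\<lambda>v. v $ i) has_derivative (\<lambda>h. h $ i)) (at v within A)" for i and v :: "real^2" and A
    by (rule bounded_linear.has_derivative[OF bounded_linear_vec_nth has_derivative_ident])
  have dP: "(P has_derivative P' v) (at v within S)" for v
  proof -
    have "(c has_derivative (\<lambda>h. h *\<^sub>R c1 (v$2))) (at (v$2))"
      using der[of "v$2"] by (simp add: has_vector_derivative_def)
    then have "((\<lambda>v. c (v$2)) has_derivative (\<lambda>h. (h$2) *\<^sub>R c1 (v$2))) (at v within S)"
      by (rule has_derivative_compose[OF nth])
    then show ?thesis unfolding P_def P'_def
      by (auto intro!: derivative_eq_intros nth simp: algebra_simps)
  qed
  have dH: "(H has_derivative H' v) (at v within S)" for v
  proof -
    have "(G has_derivative (\<lambda>h. g (v$2) * h)) (at (v$2))"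
      using dG[of "v$2"] by (simp add: has_field_derivative_def)
    then have "((\<lambda>v. G (v$2)) has_derivative (\<lambda>h. g (v$2) * (h$2))) (at v within S)"
      by (rule has_derivative_compose[OF nth])
    then show ?thesis unfolding H_def H'_def
      by (auto intro!: derivative_eq_intros nth)
  qed
  have detP: "det (matrix (P' v)) = (v$1) * g (v$2)" for v
    unfolding P'_def g_def by (simp add: det_2 matrix_def axis_def cross2_def algebra_simps)
  have detH: "det (matrix (H' v)) = (v$1) * g (v$2)" for v
    unfolding H'_def by (simp add: det_2 matrix_def axis_def)
  have Sleb: "S \<in> sets lebesgue" unfolding S_def by simp
  have "continuous_on A (\<lambda>v::real^2. v $ i)" for A i by (intro continuous_intros)
  then have "continuous_on A (\<lambda>v::real^2. \<bar>v $ 1 * g (v $ 2)\<bar>)" for A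
    by (intro continuous_intros continuous_on_compose2[OF cg]) auto
  then have int: "(\<lambda>v::real^2. \<bar>v $ 1 * g (v $ 2)\<bar>) integrable_on S"
    unfolding S_def integrable_on_open_interval by (intro integrable_continuous)
  have injP: "inj_on P S"
  proof -
    have key: "v = w" if vw: "v \<in> S" "w \<in> S" "P v = P w" "v$1 \<le> w$1" for v w
    proof -
      define r where "r = (v$1) / (w$1)"
      have r: "0 < r" "r \<le> 1" "v$1 = r * (w$1)" using vw by (auto simp: memS r_def field_simps)
      have "(w$1) *\<^sub>R (r *\<^sub>R (c (v$2) - z)) = (w$1) *\<^sub>R (c (w$2) - z)"
        using vw(3) r(3) by (simp add: P_def mult.commute)
      then have e: "r *\<^sub>R (c (v$2) - z) = c (w$2) - z"
        using vw(2) by (metis memS less_irrefl scaleR_cancel_left)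
      have "c (v$2) \<in> frontier K" "c (w$2) \<in> frontier K" using vw fr by (auto simp: memS)
      have "r = 1"
      proof (rule ccontr)
        assume "r \<noteq> 1"
        then have "c (v$2) - (1 - r) *\<^sub>R (c (v$2) - z) \<in> interior K"
          using \<open>c (v$2) \<in> frontier K\<close> r
          by (intro mem_interior_closure_convex_shrink[OF K(1) z]) (auto simp: frontier_def)
        moreover have "c (v$2) - (1 - r) *\<^sub>R (c (v$2) - z) = c (w$2)"
          using e by (simp add: algebra_simps)
        ultimately show False using \<open>c (w$2) \<in> frontier K\<close> by (simp add: frontier_def)
      qed
      then have "v$1 = w$1" "c (v$2) = c (w$2)" using r e by auto
      moreover have "v$2 = w$2" using \<open>c (v$2) = c (w$2)\<close> vw inj by (auto simp: memS inj_on_def)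
      ultimately show ?thesis by (simp add: vec_eq_iff forall_2)
    qed
    show ?thesis
    proof (rule inj_onI)
      fix v w assume "v \<in> S" "w \<in> S" "P v = P w"
      then show "v = w" using key[of v w] key[of w v] by (cases "v$1 \<le> w$1") auto
    qed
  qed
  have Hc: "H v $ 1 = (v$1)\<^sup>2 / 2" "H v $ 2 = G (v$2)" for v
    by (simp_all add: H_def axis_def)
  have injH: "inj_on H S"
  proof (rule inj_onI)
    fix v w assume vw: "v \<in> S" "w \<in> S" "H v = H w"
    then have "(v$1)\<^sup>2 = (w$1)\<^sup>2" "G (v$2) = G (w$2)" using Hc[of v] Hc[of w] by auto
    moreover have "v$1 = w$1" using vw calculation(1) by (simp add: memS)
    moreover have "v$2 = w$2" using calculation(2) Gmono[of "v$2" "w$2"] Gmono[of "w$2" "v$2"]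
      by (cases "v$2" "w$2" rule: linorder_cases) auto
    ultimately show "v = w" by (simp add: vec_eq_iff forall_2)
  qed
  have G0': "G 0 = 0" by (simp add: G_def)
  have imH: "H ` S = box (vector [0, 0]) (vector [1/2, G T])"
  proof (intro equalityI subsetI)
    fix y assume "y \<in> H ` S"
    then obtain v where v: "v \<in> S" "y = H v" by blast
    have "(v$1)\<^sup>2 < 1" using v(1) by (simp add: memS power_less_one_iff)
    then show "y \<in> box (vector [0, 0]) (vector [1/2, G T])"
      using v Gmono[of 0 "v$2"] Gmono[of "v$2" T] by (simp add: mem_cart_box2 memS Hc G0')
  next
    fix y :: "real^2" assume "y \<in> box (vector [0, 0]) (vector [1/2, G T])"
    then have y: "0 < y$1" "y$1 < 1/2" "0 < y$2" "y$2 < G T" by (simp_all add: mem_cart_box2)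
    have "continuous_on {0..T} G" by (intro continuous_at_imp_continuous_on ballI DERIV_isCont[OF dG])
    then obtain t where t: "0 \<le> t" "t \<le> T" "G t = y$2"
      using IVT'[of G 0 "y$2" T] y T G0' by auto
    have "t \<noteq> 0" "t \<noteq> T" using t y G0' by auto
    define v :: "real^2" where "v = vector [sqrt (2 * y$1), t]"
    have "v \<in> S" using t y \<open>t \<noteq> 0\<close> \<open>t \<noteq> T\<close> by (simp add: memS v_def)
    moreover have "H v = y" using y t by (simp add: vec_eq_iff forall_2 Hc) (simp add: v_def)
    ultimately show "y \<in> H ` S" by blast
  qed
  have "measure lebesgue (P ` S) = integral S (\<lambda>v. \<bar>det (matrix (P' v))\<bar>)"
    by (rule measure_differentiable_image_eq[OF Sleb dP injP]) (simp add: detP int)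
  also have "\<dots> = integral S (\<lambda>v. \<bar>det (matrix (H' v))\<bar>)" by (simp add: detP detH)
  also have "\<dots> = measure lebesgue (H ` S)"
    by (rule measure_differentiable_image_eq[OF Sleb dH injH, symmetric]) (simp add: detH int)
  also have "\<dots> = 1/2 * G T"
    unfolding imH by (rule measure_cart_box2) (use Gmono[OF T] G0' in auto)
  finally have mP: "measure lebesgue (P ` S) = 1/2 * G T" .
  \<comment> \<open>a normal of the line through \<open>z\<close> and \<open>c 0\<close>; the missing ray lies on this line\<close>
  define n :: "real^2" where "n = vector [(c 0 - z)$2, - (c 0 - z)$1]"
  have "c 0 \<noteq> z" using pos[of 0] by (auto simp: cross2_def)
  then have "n \<noteq> 0" by (auto simp: n_def vec_eq_iff forall_2)
  then have negl: "negligible (frontier K \<union> {x. n \<bullet> x = n \<bullet> z})"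
    by (intro negligible_Un negligible_hyperplane negligible_convex_frontier[OF K(1)]) simp
  have n0: "n \<bullet> (z + d *\<^sub>R (c 0 - z)) = n \<bullet> z" for d
    by (simp add: n_def inner_vec_def sum_2 algebra_simps)
  have "P ` S - K \<union> (K - P ` S) \<subseteq> frontier K \<union> {x. n \<bullet> x = n \<bullet> z}"
  proof -
    have "P v \<in> K" if "v \<in> S" for v
    proof -
      have "c (v$2) \<in> closure K" using that fr by (auto simp: memS frontier_def)
      then have "c (v$2) - (1 - v$1) *\<^sub>R (c (v$2) - z) \<in> interior K"
        using that by (intro mem_interior_closure_convex_shrink[OF K(1) z]) (auto simp: memS)
      moreover have "c (v$2) - (1 - v$1) *\<^sub>R (c (v$2) - z) = P v"
        by (simp add: P_def algebra_simps)
      ultimately show ?thesis using interior_subset by auto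
    qed
    moreover have "x \<in> P ` S" if x: "x \<in> K" "x \<notin> frontier K" "n \<bullet> x \<noteq> n \<bullet> z" for x
    proof -
      have xi: "x \<in> interior K" using x closure_subset by (auto simp: frontier_def)
      have "x - z \<noteq> 0" using x by auto
      then obtain d where d: "0 < d" "z + d *\<^sub>R (x - z) \<in> frontier K"
        using ray_to_frontier[OF K(2) z] by metis
      have "d > 1"
      proof (rule ccontr)
        assume "\<not> d > 1"
        then have "(1 - d) *\<^sub>R z + d *\<^sub>R x \<in> interior K"
          using convex_interior[OF K(1)] z xi d by (intro convexD) auto
        moreover have "(1 - d) *\<^sub>R z + d *\<^sub>R x = z + d *\<^sub>R (x - z)" by (simp add: algebra_simps)
        ultimately show False using d by (simp add: frontier_def)
      qed
      obtain t where t: "t \<in> {0..T}" "z + d *\<^sub>R (x - z) = c t" using d fr by auto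
      have xt: "x = z + (1 / d) *\<^sub>R (c t - z)" using d by (simp flip: t(2))
      have "t \<noteq> 0" "t \<noteq> T" using n0[of "1 / d"] x(3) xt closed by auto
      then have "vector [1 / d, t] \<in> S" using t \<open>d > 1\<close> by (simp add: memS)
      moreover have "P (vector [1 / d, t]) = x" by (simp add: P_def xt)
      ultimately show ?thesis by force
    qed
    ultimately show ?thesis by blast
  qed
  then have "negligible (P ` S - K \<union> (K - P ` S))" using negl negligible_subset by blast
  then have "negligible (K - P ` S \<union> (P ` S - K))" by (simp add: Un_commute)
  then have "measure lebesgue (P ` S) = measure lebesgue K"
    by (rule measure_negligible_symdiff[OF measurable_convex[OF K]])
  then show ?thesis using mP Gint unfolding g_def by simp
qed

section \<open>Normal vectors of an oval\<close>

lemma inner_real2: "v \<bullet> w = v$1 * w$1 + v$2 * w$2" for v w :: "real^2"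
  by (simp add: inner_vec_def sum_2)

lemma unit_dir_nth [simp]: "unit_dir \<theta> $ 1 = cos \<theta>" "unit_dir \<theta> $ 2 = sin \<theta>"
  by (simp_all add: unit_dir_def)

lemma unit_dir_add_pi: "unit_dir (\<theta> + pi) = - unit_dir \<theta>"
  by (simp add: vec_eq_iff forall_2)

lemma norm_unit_dir [simp]: "norm (unit_dir \<theta>) = 1"
  by (simp add: norm_vec_def L2_set_def sum_2)

lemma has_real_derivative_nth:
  fixes c :: "real \<Rightarrow> real^2"
  assumes "(c has_vector_derivative c') (at t)"
  shows "((\<lambda>t. c t $ i) has_real_derivative c' $ i) (at t)"
  using bounded_linear.has_vector_derivative[OF bounded_linear_vec_nth assms]
  by (simp add: has_real_derivative_iff_has_vector_derivative)

text \<open>If the second derivative were positive, then \<open>f1\<close> would be positive to the right of \<open>t\<close>, and \<open>f\<close>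
would exceed its maximum there.\<close>
lemma second_derivative_at_max:
  fixes f f1 :: "real \<Rightarrow> real"
  assumes der: "\<And>x. (f has_real_derivative f1 x) (at x)"
    and der1: "(f1 has_real_derivative d) (at t)"
    and max: "\<And>x. f x \<le> f t"
  shows "f1 t = 0" "d \<le> 0"
proof -
  show f0: "f1 t = 0"
    by (rule DERIV_local_max[OF der[of t] zero_less_one]) (use max in auto)
  show "d \<le> 0"
  proof (rule ccontr)
    assume "\<not> d \<le> 0"
    then have "d > 0" by simp
    then obtain e where e: "e > 0" "\<And>h. 0 < h \<Longrightarrow> h < e \<Longrightarrow> f1 t < f1 (t + h)"
      using DERIV_pos_inc_right[OF der1] by blast
    have "f t < f (t + e / 2)"
    proof (rule DERIV_pos_imp_increasing_open[of t "t + e / 2" f])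
      show "t < t + e / 2" using e by simp
      show "\<exists>y. (f has_real_derivative y) (at x) \<and> 0 < y" if "t < x" "x < t + e / 2" for x
        using der[of x] e(2)[of "x - t"] that f0 by (intro exI[of _ "f1 x"]) auto
      show "continuous_on {t..t + e / 2} f" by (rule deriv_imp_continuous_on_UNIV[OF der])
    qed
    then show False using max[of "t + e / 2"] by simp
  qed
qed

text \<open>The counterclockwise case with \<open>c1\<close> and \<open>c2\<close> as first and second derivative. Keeping them as
parameters allows a reversed curve to be an instance.\<close>
locale positive_oval =
  fixes K :: "(real^2) set" and c c1 c2 :: "real \<Rightarrow> real^2" and T :: real and z :: "real^2"
  assumes scd: "strictly_convex_domain K"
    and T: "0 < T"
    and der: "\<And>t. (c has_vector_derivative c1 t) (at t)"
    and der1: "\<And>t. (c1 has_vector_derivative c2 t) (at t)"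
    and cont2: "continuous_on UNIV c2"
    and per: "\<And>t. c (t + T) = c t"
    and inj: "inj_on c {0..<T}"
    and pos: "\<And>t. cross2 (c1 t) (c2 t) > 0"
    and frontier_K: "frontier K = c ` {0..T}"
    and z: "z \<in> interior K"
begin

lemma convex_K: "convex K"
  using scd by (rule strictly_convex_domain_imp_convex)

lemma continuous_c: "continuous_on A c" and continuous_c1: "continuous_on A c1"
  by (auto intro!: continuous_at_imp_continuous_on has_vector_derivative_continuous[OF der]
      has_vector_derivative_continuous[OF der1])

lemma bounded_K: "bounded K"
proof (rule bounded_of_bounded_frontier_convex[OF convex_K])
  show "bounded (frontier K)"
    unfolding frontier_K by (intro compact_imp_bounded compact_continuous_image continuous_c) simp
  show "frontier K \<noteq> {}" using T by (auto simp: frontier_K)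
qed

lemma per1: "c1 (t + T) = c1 t" and per2: "c2 (t + T) = c2 t"
proof -
  have p1: "c1 (t + T) = c1 t" for t
  proof (simp only: vec_eq_iff, intro allI)
    fix i
    show "c1 (t + T) $ i = c1 t $ i"
      using deriv_shift[OF has_real_derivative_nth[OF der], where a = T and x = t] has_real_derivative_nth[OF der, of i t]
      unfolding per by (rule DERIV_unique)
  qed
  then show "c1 (t + T) = c1 t" .
  show "c2 (t + T) = c2 t"
  proof (simp only: vec_eq_iff, intro allI)
    fix i
    show "c2 (t + T) $ i = c2 t $ i"
      using deriv_shift[OF has_real_derivative_nth[OF der1], where a = T and x = t] has_real_derivative_nth[OF der1, of i t]
      unfolding p1 by (rule DERIV_unique)
  qed
qed

sublocale c: periodic_fun_simple c T by standard (rule per)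

lemma c_in_frontier: "c t \<in> frontier K"
proof -
  define n where "n = \<lfloor>t / T\<rfloor>"
  have "of_int n \<le> t / T" "t / T < of_int n + 1" unfolding n_def by linarith+
  then have "t - of_int n * T \<in> {0..T}" using T by (auto simp: field_simps)
  moreover have "c (t - of_int n * T) = c t" by (rule c.minus_of_int)
  ultimately show ?thesis unfolding frontier_K by (metis image_eqI)
qed

lemma c1_nonzero: "c1 t \<noteq> 0"
  using pos[of t] by (auto simp: cross2_def)

definition normal :: "real \<Rightarrow> real^2" where
  "normal t = vector [c1 t $ 2, - (c1 t $ 1)]"

lemma normal_inner: "normal t \<bullet> v = cross2 v (c1 t)"
  by (simp add: normal_def inner_real2 cross2_def algebra_simps)

text \<open>Some line supports the convex set at \<open>c t\<close>; let \<open>a\<close> be its outer normal. Since \<open>a \<bullet> c s\<close> is maximal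
at \<open>s = t\<close>, the vector \<open>a\<close> is orthogonal to the tangent, and so it is a multiple \<open>\<mu>\<close> of \<open>normal t\<close>. The second
derivative \<open>a \<bullet> c2 t = - \<mu> cross2 (c1 t) (c2 t)\<close> is not positive, and the sign of the curvature
gives \<open>\<mu> > 0\<close>: the curvature decides on which side the domain lies.\<close>
lemma normal_supports:
  assumes "x \<in> closure K"
  shows "normal t \<bullet> x \<le> normal t \<bullet> c t"
proof -
  have "c t \<in> closure K" "c t \<notin> rel_interior K"
    using c_in_frontier[of t] rel_interior_nonempty_interior[of K] z by (auto simp: frontier_def)
  then obtain b where b: "b \<noteq> 0" "\<And>y. y \<in> closure K \<Longrightarrow> b \<bullet> c t \<le> b \<bullet> y"
    using supporting_hyperplane_relative_frontier[OF convex_K] by metis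
  define a where "a = - b"
  have a: "a \<noteq> 0" "\<And>y. y \<in> closure K \<Longrightarrow> a \<bullet> y \<le> a \<bullet> c t" using b by (auto simp: a_def)
  have d: "((\<lambda>s. a \<bullet> c s) has_real_derivative a \<bullet> c1 s) (at s)" for s
    using bounded_linear.has_vector_derivative[OF bounded_linear_inner_right der]
    by (simp add: has_real_derivative_iff_has_vector_derivative)
  have d1: "((\<lambda>s. a \<bullet> c1 s) has_real_derivative a \<bullet> c2 t) (at t)"
    using bounded_linear.has_vector_derivative[OF bounded_linear_inner_right der1]
    by (simp add: has_real_derivative_iff_has_vector_derivative)
  have "a \<bullet> c s \<le> a \<bullet> c t" for s
    using a(2) c_in_frontier by (auto simp: frontier_def)
  note m = second_derivative_at_max[OF d d1 this]
  define R where "R = (c1 t $ 1)\<^sup>2 + (c1 t $ 2)\<^sup>2"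
  have R: "R > 0" using c1_nonzero[of t]
    by (auto simp: R_def vec_eq_iff forall_2 sum_power2_gt_zero_iff)
  define \<mu> where "\<mu> = (a \<bullet> normal t) / R"
  have a\<mu>: "a = \<mu> *\<^sub>R normal t"
  proof -
    have o: "a$1 * c1 t $ 1 + a$2 * c1 t $ 2 = 0" using m(1) by (simp add: inner_real2)
    have "a$1 * R = (a \<bullet> normal t) * c1 t $ 2 + (a$1 * c1 t $ 1 + a$2 * c1 t $ 2) * c1 t $ 1"
      "a$2 * R = - (a \<bullet> normal t) * c1 t $ 1 + (a$1 * c1 t $ 1 + a$2 * c1 t $ 2) * c1 t $ 2"
      by (simp_all add: R_def inner_real2 normal_def algebra_simps power2_eq_square)
    then show ?thesis using R unfolding o
      by (simp add: vec_eq_iff forall_2 \<mu>_def normal_def field_simps)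
  qed
  have "a \<bullet> c2 t = - \<mu> * cross2 (c1 t) (c2 t)"
    unfolding a\<mu> by (simp add: normal_inner) (simp add: cross2_def algebra_simps)
  then have "\<mu> \<ge> 0" using m(2) pos[of t] by (simp add: zero_le_mult_iff)
  moreover have "\<mu> \<noteq> 0" using a a\<mu> by auto
  ultimately have "\<mu> > 0" by simp
  then show ?thesis using a(2)[OF assms] unfolding a\<mu> by simp
qed

lemma normal_supports_interior:
  assumes x: "x \<in> interior K"
  shows "normal t \<bullet> x < normal t \<bullet> c t"
proof -
  have n0: "normal t \<noteq> 0" using c1_nonzero[of t] by (auto simp: normal_def vec_eq_iff forall_2)
  obtain e where e: "e > 0" "cball x e \<subseteq> K" using x by (meson mem_interior_cball)
  define y where "y = x + (e / norm (normal t)) *\<^sub>R normal t"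
  have "y \<in> closure K"
  proof -
    have "dist x y \<le> e" using e n0 by (simp add: y_def dist_norm)
    then show ?thesis using e closure_subset[of K] by auto
  qed
  then have "normal t \<bullet> y \<le> normal t \<bullet> c t" by (rule normal_supports)
  moreover have "normal t \<bullet> y = normal t \<bullet> x + e * norm (normal t)"
    using n0 by (simp add: y_def inner_add_right power2_norm_eq_inner[symmetric] power2_eq_square)
  moreover have "e * norm (normal t) > 0" using e n0 by simp
  ultimately show ?thesis by linarith
qed

lemma star_shaped: "cross2 (c t - z) (c1 t) > 0"
  using normal_supports_interior[OF z, of t] by (simp add: inner_diff_right flip: normal_inner)

lemma area_eq: "measure lebesgue K = 1 / 2 * integral {0..T} (\<lambda>t. cross2 (c t - z) (c1 t))"
proof (rule area_enclosed_by_star_shaped_curve[OF convex_K bounded_K z frontier_K T der continuous_c1])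
  show "inj_on c {0<..<T}" using inj by (rule inj_on_subset) auto
  show "c T = c 0" using per[of 0] by simp
qed (rule star_shaped)

end

section \<open>The normal angle as a parameter\<close>

text \<open>Take \<open>\<phi>\<close> as a primitive of the angular velocity with the right initial value. The components \<open>P\<close>, \<open>Q\<close>
of the rotated tangent vector in the frame with angle \<open>\<phi>\<close> and its length \<open>r\<close> satisfy the same linear
differential equation, so \<open>P / r\<close> and \<open>Q / r\<close> keep their initial values \<open>0\<close> and \<open>1\<close>.\<close>
lemma tangent_angle_exists:
  fixes x1 x2 y1 y2 :: "real \<Rightarrow> real"
  assumes dx: "\<And>t. (x1 has_real_derivative x2 t) (at t)"
    and dy: "\<And>t. (y1 has_real_derivative y2 t) (at t)"
    and cx: "continuous_on UNIV x2" and cy: "continuous_on UNIV y2"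
    and pos: "\<And>t. (x1 t)\<^sup>2 + (y1 t)\<^sup>2 > 0"
  defines "r \<equiv> \<lambda>t. sqrt ((x1 t)\<^sup>2 + (y1 t)\<^sup>2)"
  obtains \<phi> where
    "\<And>t. (\<phi> has_real_derivative (x1 t * y2 t - y1 t * x2 t) / (r t)\<^sup>2) (at t)"
    "\<And>t. x1 t = - r t * sin (\<phi> t)" "\<And>t. y1 t = r t * cos (\<phi> t)"
proof -
  have r: "r t > 0" "(r t)\<^sup>2 = (x1 t)\<^sup>2 + (y1 t)\<^sup>2" for t
    using pos[of t] by (simp_all add: r_def)
  have dr: "(r has_real_derivative (x1 t * x2 t + y1 t * y2 t) / r t) (at t)" for t
  proof -
    have d: "((\<lambda>t. (x1 t)\<^sup>2 + (y1 t)\<^sup>2) has_real_derivative 2 * (x1 t * x2 t + y1 t * y2 t)) (at t)"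
      by (auto intro!: derivative_eq_intros dx dy)
    have "((\<lambda>t. sqrt ((x1 t)\<^sup>2 + (y1 t)\<^sup>2)) has_real_derivative
        inverse (sqrt ((x1 t)\<^sup>2 + (y1 t)\<^sup>2)) / 2 * (2 * (x1 t * x2 t + y1 t * y2 t))) (at t)"
      by (rule DERIV_chain2[where f = sqrt, OF DERIV_real_sqrt[OF pos] d])
    moreover have "inverse s / 2 * (2 * u) = u / s" for s u :: real
      by (cases "s = 0") (simp_all add: field_simps)
    ultimately show ?thesis by (simp only: r_def)
  qed
  have cr: "continuous_on A r" "continuous_on A x1" "continuous_on A y1" for A
    by (rule deriv_imp_continuous_on_UNIV[OF dr] deriv_imp_continuous_on_UNIV[OF dx]
        deriv_imp_continuous_on_UNIV[OF dy])+
  define w where "w t = (x1 t * y2 t - y1 t * x2 t) / (r t)\<^sup>2" for t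
  have "r t \<noteq> 0" for t using r(1)[of t] by simp
  then have cw: "continuous_on UNIV w"
    unfolding w_def by (intro continuous_intros cr cx cy) auto
  obtain F where F: "\<And>t. (F has_real_derivative w t) (at t)"
    using antiderivative_on_UNIV[OF cw] by blast
  have "(y1 0 / r 0)\<^sup>2 + (- x1 0 / r 0)\<^sup>2 = 1"
    unfolding power_divide power2_minus r(2) add_divide_distrib[symmetric]
    using pos[of 0] by (auto simp: add.commute)
  then obtain \<alpha> where \<alpha>: "y1 0 / r 0 = cos \<alpha>" "- x1 0 / r 0 = sin \<alpha>"
    using sincos_total_2pi by metis
  define \<phi> where "\<phi> t = F t - F 0 + \<alpha>" for t
  have d\<phi>: "(\<phi> has_real_derivative w t) (at t)" for t
    unfolding \<phi>_def by (auto intro!: derivative_eq_intros F)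
  define P where "P t = - y1 t * sin (\<phi> t) - x1 t * cos (\<phi> t)" for t
  define Q where "Q t = y1 t * cos (\<phi> t) - x1 t * sin (\<phi> t)" for t
  have w: "w t * (r t)\<^sup>2 = x1 t * y2 t - y1 t * x2 t" for t
    using r(1)[of t] by (simp add: w_def)
  have const: "f t / r t = f 0 / r 0"
    if "\<And>t. (f has_real_derivative f' t) (at t)" 
       "\<And>t. f' t * (r t)\<^sup>2 = f t * (x1 t * x2 t + y1 t * y2 t)" for f f' t
  proof -
    have "((\<lambda>t. f t / r t) has_real_derivative 0) (at t)" for t
    proof -
      have "((\<lambda>t. f t / r t) has_real_derivative
          (f' t * r t - f t * ((x1 t * x2 t + y1 t * y2 t) / r t)) / (r t * r t)) (at t)"
        by (rule DERIV_divide[OF that(1) dr]) (use r(1)[of t] in simp)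
      moreover have "f' t * r t - f t * ((x1 t * x2 t + y1 t * y2 t) / r t) = 0"
        using that(2)[of t] r(1)[of t] by (simp add: field_simps power2_eq_square)
      ultimately show ?thesis by simp
    qed
    then show ?thesis by (rule DERIV_isconst_all[rule_format])
  qed
  have P0: "P t = 0" for t
  proof -
    define P' where "P' t = - y2 t * sin (\<phi> t) - y1 t * cos (\<phi> t) * w t
        - x2 t * cos (\<phi> t) + x1 t * sin (\<phi> t) * w t" for t
    have "(P has_real_derivative P' t) (at t)" for t
      unfolding P_def P'_def by (auto intro!: derivative_eq_intros dx dy d\<phi>)
    moreover have "P' t * (r t)\<^sup>2 = P t * (x1 t * x2 t + y1 t * y2 t)" for t
    proof -
      have "P' t * (r t)\<^sup>2 = (- y2 t * sin (\<phi> t) - x2 t * cos (\<phi> t)) * (r t)\<^sup>2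
         + (x1 t * sin (\<phi> t) - y1 t * cos (\<phi> t)) * (w t * (r t)\<^sup>2)"
        unfolding P'_def by (simp add: algebra_simps)
      also have "\<dots> = P t * (x1 t * x2 t + y1 t * y2 t)"
        unfolding w unfolding r(2) P_def by (simp add: algebra_simps power2_eq_square)
      finally show ?thesis .
    qed
    ultimately have "P t / r t = P 0 / r 0" by (rule const)
    moreover have "P 0 = 0"
      using \<alpha> r(1)[of 0] by (simp add: P_def \<phi>_def flip: \<alpha>)
    ultimately show ?thesis using r(1)[of t] by simp
  qed
  have Qr: "Q t = r t" for t
  proof -
    define Q' where "Q' t = y2 t * cos (\<phi> t) - y1 t * sin (\<phi> t) * w t
        - x2 t * sin (\<phi> t) - x1 t * cos (\<phi> t) * w t" for t
    have "(Q has_real_derivative Q' t) (at t)" for t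
      unfolding Q_def Q'_def by (auto intro!: derivative_eq_intros dx dy d\<phi>)
    moreover have "Q' t * (r t)\<^sup>2 = Q t * (x1 t * x2 t + y1 t * y2 t)" for t
    proof -
      have "Q' t * (r t)\<^sup>2 = (y2 t * cos (\<phi> t) - x2 t * sin (\<phi> t)) * (r t)\<^sup>2
         - (y1 t * sin (\<phi> t) + x1 t * cos (\<phi> t)) * (w t * (r t)\<^sup>2)"
        unfolding Q'_def by (simp add: algebra_simps)
      also have "\<dots> = Q t * (x1 t * x2 t + y1 t * y2 t)"
        unfolding w unfolding r(2) Q_def by (simp add: algebra_simps power2_eq_square)
      finally show ?thesis .
    qed
    ultimately have "Q t / r t = Q 0 / r 0" by (rule const)
    moreover have "Q 0 = r 0"
    proof -
      have "Q 0 = ((x1 0)\<^sup>2 + (y1 0)\<^sup>2) / r 0"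
        by (simp add: Q_def \<phi>_def power2_eq_square add_divide_distrib flip: \<alpha>)
      then show ?thesis unfolding r(2)[symmetric] using r(1)[of 0] by (simp add: power2_eq_square)
    qed
    ultimately show ?thesis using r(1)[of t] r(1)[of 0] by simp
  qed
  have "y1 t = Q t * cos (\<phi> t) - P t * sin (\<phi> t)" "x1 t = - (Q t * sin (\<phi> t) + P t * cos (\<phi> t))" for t
  proof -
    have "Q t * cos (\<phi> t) - P t * sin (\<phi> t) = y1 t * ((sin (\<phi> t))\<^sup>2 + (cos (\<phi> t))\<^sup>2)"
      unfolding P_def Q_def by (simp add: algebra_simps power2_eq_square del: sin_cos_squared_add sin_cos_squared_add3)
    then show "y1 t = Q t * cos (\<phi> t) - P t * sin (\<phi> t)" by simp
    have "- (Q t * sin (\<phi> t) + P t * cos (\<phi> t)) = x1 t * ((sin (\<phi> t))\<^sup>2 + (cos (\<phi> t))\<^sup>2)"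
      unfolding P_def Q_def by (simp add: algebra_simps power2_eq_square del: sin_cos_squared_add sin_cos_squared_add3)
    then show "x1 t = - (Q t * sin (\<phi> t) + P t * cos (\<phi> t))" by simp
  qed
  then show ?thesis
    using that[of \<phi>] d\<phi> P0 Qr unfolding w_def by simp
qed

context positive_oval
begin

definition speed :: "real \<Rightarrow> real" where "speed t = norm (c1 t)"

definition turning_rate :: "real \<Rightarrow> real" where
  "turning_rate t = cross2 (c1 t) (c2 t) / (speed t)\<^sup>2"

lemma speed_pos: "speed t > 0"
  using c1_nonzero by (simp add: speed_def)

lemma turning_rate_pos: "turning_rate t > 0"
  using pos[of t] speed_pos[of t] by (simp add: turning_rate_def)

lemma speed_periodic: "speed (t + T) = speed t"
  and turning_rate_periodic: "turning_rate (t + T) = turning_rate t"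
  by (simp_all add: speed_def turning_rate_def per1 per2)

lemma continuous_speed: "continuous_on A speed"
  unfolding speed_def by (intro continuous_intros continuous_c1)

lemma continuous_turning_rate: "continuous_on UNIV turning_rate"
proof -
  have "speed t \<noteq> 0" for t using speed_pos[of t] by simp
  then show ?thesis
    unfolding turning_rate_def cross2_def
    by (intro continuous_intros continuous_speed continuous_c1 cont2) auto
qed

lemma normal_angle_exists:
  obtains \<phi> where "\<And>t. (\<phi> has_real_derivative turning_rate t) (at t)"
    and "\<And>t. normal t = speed t *\<^sub>R unit_dir (\<phi> t)"
proof -
  have sp: "sqrt ((c1 t $ 1)\<^sup>2 + (c1 t $ 2)\<^sup>2) = speed t" for t
    by (simp add: speed_def norm_vec_def L2_set_def sum_2)
  have "(c1 t $ 1)\<^sup>2 + (c1 t $ 2)\<^sup>2 > 0" for t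
    using speed_pos[of t] unfolding sp[symmetric] by simp
  moreover have "continuous_on UNIV (\<lambda>t. c2 t $ i)" for i by (intro continuous_intros cont2)
  ultimately obtain \<phi> where \<phi>:
    "\<And>t. (\<phi> has_real_derivative (c1 t $ 1 * c2 t $ 2 - c1 t $ 2 * c2 t $ 1) / (speed t)\<^sup>2) (at t)"
    "\<And>t. c1 t $ 1 = - speed t * sin (\<phi> t)" "\<And>t. c1 t $ 2 = speed t * cos (\<phi> t)"
    using tangent_angle_exists[OF has_real_derivative_nth[OF der1, of 1] has_real_derivative_nth[OF der1, of 2],
        unfolded sp] by blast
  show ?thesis
  proof
    show "(\<phi> has_real_derivative turning_rate t) (at t)" for t
      using \<phi>(1) by (simp add: turning_rate_def cross2_def)
    show "normal t = speed t *\<^sub>R unit_dir (\<phi> t)" for t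
      using \<phi>(2,3) by (simp add: normal_def vec_eq_iff forall_2)
  qed
qed

text \<open>Two different points with the same outer normal would both maximise it over the domain, and so would
their midpoint, which is an interior point by strict convexity.\<close>
lemma same_normal_imp_same_point:
  assumes "normal s = a *\<^sub>R u" "normal t = b *\<^sub>R u" "a > 0" "b > 0"
  shows "c s = c t"
proof (rule ccontr)
  assume ne: "c s \<noteq> c t"
  have cl: "c s \<in> closure K" "c t \<in> closure K" using c_in_frontier by (auto simp: frontier_def)
  have "midpoint (c s) (c t) \<in> open_segment (c s) (c t)" using ne by simp
  then have "midpoint (c s) (c t) \<in> interior K"
    using scd cl ne unfolding strictly_convex_domain_def by blast
  then have "normal t \<bullet> midpoint (c s) (c t) < normal t \<bullet> c t" by (rule normal_supports_interior)
  then have "normal t \<bullet> c s < normal t \<bullet> c t"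
    by (simp add: midpoint_def inner_add_right field_simps)
  moreover have "normal s \<bullet> c t \<le> normal s \<bullet> c s" by (rule normal_supports[OF cl(2)])
  ultimately show False using assms by simp
qed

text \<open>The normal angle \<open>\<phi>\<close> increases over a period by \<open>2 pi n\<close> for a positive integer \<open>n\<close>. For \<open>n \<ge> 2\<close> the angle
\<open>\<phi> 0 + 2 pi\<close> would be reached inside the period, at a point with the same normal as \<open>c 0\<close> but different
from it. So \<open>n = 1\<close>, \<open>\<phi>\<close> is a bijection of the line, and \<open>\<psi>\<close> is its inverse.\<close>
lemma normal_parametrization_exists:
  obtains \<psi> \<theta>0 where "\<And>\<theta>. (\<psi> has_real_derivative 1 / turning_rate (\<psi> \<theta>)) (at \<theta>)"
    and "\<And>\<theta>. \<psi> (\<theta> + 2 * pi) = \<psi> \<theta> + T"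
    and "\<And>\<theta>. normal (\<psi> \<theta>) = speed (\<psi> \<theta>) *\<^sub>R unit_dir \<theta>"
    and "\<psi> \<theta>0 = 0"
proof -
  obtain \<phi> where d\<phi>: "\<And>t. (\<phi> has_real_derivative turning_rate t) (at t)"
    and n\<phi>: "\<And>t. normal t = speed t *\<^sub>R unit_dir (\<phi> t)"
    using normal_angle_exists by blast
  have cont: "continuous_on A \<phi>" for A by (rule deriv_imp_continuous_on_UNIV[OF d\<phi>])
  have mono: "\<phi> s < \<phi> t" if "s < t" for s t
    using DERIV_pos_imp_increasing[OF that, of \<phi>] d\<phi> turning_rate_pos by blast
  have same: "c s = c t" if "unit_dir (\<phi> s) = unit_dir (\<phi> t)" for s t
    using same_normal_imp_same_point[OF n\<phi>[of s] _ speed_pos speed_pos] n\<phi>[of t] that by simp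
  have step0: "\<phi> T = \<phi> 0 + 2 * pi"
  proof -
    have "normal (0 + T) = normal 0" by (simp only: normal_def per1)
    then have "speed 0 *\<^sub>R unit_dir (\<phi> T) = speed 0 *\<^sub>R unit_dir (\<phi> 0)"
      using n\<phi>[of T] n\<phi>[of 0] speed_periodic[of 0] by simp
    then have "unit_dir (\<phi> T) = unit_dir (\<phi> 0)" using speed_pos[of 0] by simp
    then have "sin (\<phi> T) = sin (\<phi> 0) \<and> cos (\<phi> T) = cos (\<phi> 0)"
      by (simp add: vec_eq_iff forall_2)
    then obtain n :: int where n: "\<phi> T = \<phi> 0 + 2 * pi * n" using sin_cos_eq_iff by blast
    have "2 * pi * n > 0" using mono[OF T] n by simp
    then have "n \<ge> 1" by (simp add: zero_less_mult_iff)
    moreover have "\<not> n \<ge> 2"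
    proof
      assume "n \<ge> 2"
      then have "2 * pi * 2 \<le> 2 * pi * n" by (intro mult_left_mono) auto
      then have "\<phi> 0 + 2 * pi < \<phi> T" using n pi_gt_zero by linarith
      then obtain s where s: "0 \<le> s" "s \<le> T" "\<phi> s = \<phi> 0 + 2 * pi"
        using IVT'[of \<phi> 0 "\<phi> 0 + 2 * pi" T] cont T by auto
      then have "unit_dir (\<phi> s) = unit_dir (\<phi> 0)" by (simp add: vec_eq_iff forall_2)
      then have "c s = c 0" by (rule same)
      moreover have "s < T" using s \<open>\<phi> 0 + 2 * pi < \<phi> T\<close> by (cases "s = T") auto
      ultimately have "s = 0" using inj s T by (auto simp: inj_on_def)
      then show False using s by simp
    qed
    ultimately have "n = 1" by simp
    then show ?thesis using n by simp
  qed
  have step: "\<phi> (t + T) = \<phi> t + 2 * pi" for t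
  proof -
    have "((\<lambda>t. \<phi> (t + T) - \<phi> t) has_real_derivative 0) (at t)" for t
      using DERIV_diff[OF deriv_shift[OF d\<phi>, of T t] d\<phi>[of t]] by (simp add: turning_rate_periodic)
    then have "\<phi> (t + T) - \<phi> t = \<phi> (0 + T) - \<phi> 0"
      by (rule DERIV_isconst_all[rule_format, of "\<lambda>t. \<phi> (t + T) - \<phi> t"])
    then show ?thesis using step0 by simp
  qed
  have surj: "\<exists>t. \<phi> t = \<theta>" for \<theta>
  proof -
    define D where "D t = \<phi> t - 2 * pi * (t / T)" for t
    interpret D: periodic_fun_simple D T
      by standard (use T step in \<open>simp add: D_def add_divide_distrib distrib_left\<close>)
    have k: "\<phi> (of_int k * T) = \<phi> 0 + 2 * pi * of_int k" for k :: int
      using D.plus_of_int[of 0 k] T by (simp add: D_def)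
    define k where "k = \<lfloor>(\<theta> - \<phi> 0) / (2 * pi)\<rfloor>"
    have "of_int k \<le> (\<theta> - \<phi> 0) / (2 * pi)" "(\<theta> - \<phi> 0) / (2 * pi) \<le> of_int (k + 1)"
      unfolding k_def by linarith+
    then have "\<phi> (of_int k * T) \<le> \<theta>" "\<theta> \<le> \<phi> (of_int (k + 1) * T)"
      unfolding k by (simp_all add: field_simps)
    then show ?thesis
      using IVT'[of \<phi> "of_int k * T" \<theta> "of_int (k + 1) * T"] cont T by (auto simp: distrib_right)
  qed
  have inj\<phi>: "inj \<phi>"
    by (rule injI) (metis mono less_irrefl linorder_less_linear)
  define \<psi> where "\<psi> = inv \<phi>"
  have \<psi>: "\<psi> (\<phi> t) = t" "\<phi> (\<psi> \<theta>) = \<theta>" for t \<theta>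
    using inj\<phi> surj by (auto simp: \<psi>_def inv_f_f) (metis f_inv_into_f rangeI)
  show ?thesis
  proof
    show "(\<psi> has_real_derivative 1 / turning_rate (\<psi> \<theta>)) (at \<theta>)" for \<theta>
    proof -
      define w where "w = turning_rate (\<psi> \<theta>)"
      have "w \<noteq> 0" using turning_rate_pos[of "\<psi> \<theta>"] by (simp add: w_def)
      have "(\<psi> has_derivative (*) (1 / w)) (at (\<phi> (\<psi> \<theta>)))"
      proof (rule has_derivative_inverse_strong[of UNIV "\<psi> \<theta>" \<phi> \<psi> "(*) w"])
        show "(\<phi> has_derivative (*) w) (at (\<psi> \<theta>))"
          using d\<phi>[of "\<psi> \<theta>"] by (simp add: has_field_derivative_def w_def)
        show "(*) w \<circ> (*) (1 / w) = id" using \<open>w \<noteq> 0\<close> by auto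
      qed (use \<psi> cont in auto)
      then show ?thesis unfolding \<psi> has_field_derivative_def w_def .
    qed
    show "\<psi> (\<theta> + 2 * pi) = \<psi> \<theta> + T" for \<theta>
      using step[of "\<psi> \<theta>"] \<psi> by metis
    show "normal (\<psi> \<theta>) = speed (\<psi> \<theta>) *\<^sub>R unit_dir \<theta>" for \<theta>
      using n\<phi>[of "\<psi> \<theta>"] by (simp add: \<psi>)
    show "\<psi> (\<phi> 0) = 0" by (rule \<psi>)
  qed
qed

text \<open>With \<open>v \<theta>\<close> the point with normal angle \<open>\<theta>\<close>, seen from \<open>z\<close>, the derivative \<open>v'\<close> is \<open>rad \<theta>\<close> times the unit
tangent, where \<open>rad\<close> is the radius of curvature. Therefore \<open>p = unit_dir \<theta> \<bullet> v\<close> has second derivative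
\<open>rad - p\<close>. The parameter \<open>t = \<psi> \<theta>\<close> turns the length and area integrals over \<open>t\<close> into integrals over
\<open>\<theta>\<close>, with integrands \<open>rad = p + p2\<close> and \<open>p rad\<close>.\<close>
theorem support_function_properties:
  obtains p1 p2 where
    "\<And>\<theta>. (minkowski_support K c z has_real_derivative p1 \<theta>) (at \<theta>)"
    "\<And>\<theta>. (p1 has_real_derivative p2 \<theta>) (at \<theta>)"
    "continuous_on UNIV p2"
    "\<And>\<theta>. minkowski_support K c z (\<theta> + 2 * pi) = minkowski_support K c z \<theta>"
    "curve_length c T = integral {0..2*pi} (minkowski_support K c z)"
    "measure lebesgue K = 1 / 2 * integral {0..2*pi}
       (\<lambda>\<theta>. minkowski_support K c z \<theta> * (minkowski_support K c z \<theta> + p2 \<theta>))"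
    "\<And>\<theta>. \<exists>t. outer_normal_at K c t (unit_dir \<theta>) \<and>
           minkowski_support K c z \<theta> = unit_dir \<theta> \<bullet> (c t - z)"
proof -
  obtain \<psi> \<theta>0 where d\<psi>: "\<And>\<theta>. (\<psi> has_real_derivative 1 / turning_rate (\<psi> \<theta>)) (at \<theta>)"
    and per\<psi>: "\<And>\<theta>. \<psi> (\<theta> + 2 * pi) = \<psi> \<theta> + T"
    and n\<psi>: "\<And>\<theta>. normal (\<psi> \<theta>) = speed (\<psi> \<theta>) *\<^sub>R unit_dir \<theta>"
    and \<theta>0: "\<psi> \<theta>0 = 0"
    using normal_parametrization_exists by blast
  have vd: "vderiv c t = c1 t" for t
    unfolding vderiv_def by (rule vector_derivative_at[OF der])
  define p where "p \<theta> = unit_dir \<theta> \<bullet> (c (\<psi> \<theta>) - z)" for \<theta>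
  have sup: "unit_dir \<theta> \<bullet> x \<le> unit_dir \<theta> \<bullet> c (\<psi> \<theta>)" if "x \<in> closure K" for x \<theta>
    using normal_supports[OF that, of "\<psi> \<theta>"] speed_pos[of "\<psi> \<theta>"] unfolding n\<psi> by simp
  have out: "outer_normal_at K c (\<psi> \<theta>) (unit_dir \<theta>)" for \<theta>
  proof -
    have "normal (\<psi> \<theta>) \<bullet> c1 (\<psi> \<theta>) = 0" by (simp add: normal_inner cross2_def)
    then have "unit_dir \<theta> \<bullet> c1 (\<psi> \<theta>) = 0" using speed_pos[of "\<psi> \<theta>"] unfolding n\<psi> by simp
    moreover have "unit_dir \<theta> \<bullet> (x - c (\<psi> \<theta>)) \<le> 0" if "x \<in> K" for x
      using sup[of x \<theta>] that closure_subset[of K] by (auto simp: inner_diff_right)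
    ultimately show ?thesis by (simp add: outer_normal_at_def vd)
  qed
  have p: "minkowski_support K c z \<theta> = p \<theta>" for \<theta>
    unfolding minkowski_support_def
  proof (rule the_equality)
    show "\<exists>t. outer_normal_at K c t (unit_dir \<theta>) \<and> p \<theta> = unit_dir \<theta> \<bullet> (c t - z)"
      using out p_def by blast
  next
    fix h assume "\<exists>t. outer_normal_at K c t (unit_dir \<theta>) \<and> h = unit_dir \<theta> \<bullet> (c t - z)"
    then obtain t where t: "outer_normal_at K c t (unit_dir \<theta>)" "h = unit_dir \<theta> \<bullet> (c t - z)" by blast
    have "K \<subseteq> {x. unit_dir \<theta> \<bullet> x \<le> unit_dir \<theta> \<bullet> c t}"
      using t(1) by (auto simp: outer_normal_at_def inner_diff_right)
    then have "closure K \<subseteq> {x. unit_dir \<theta> \<bullet> x \<le> unit_dir \<theta> \<bullet> c t}"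
      by (intro closure_minimal closed_halfspace_le)
    then have "unit_dir \<theta> \<bullet> c (\<psi> \<theta>) \<le> unit_dir \<theta> \<bullet> c t"
      using c_in_frontier[of "\<psi> \<theta>"] by (auto simp: frontier_def)
    moreover have "unit_dir \<theta> \<bullet> c t \<le> unit_dir \<theta> \<bullet> c (\<psi> \<theta>)"
      using sup[of "c t" \<theta>] c_in_frontier[of t] by (auto simp: frontier_def)
    ultimately show "h = p \<theta>" by (simp add: t(2) p_def inner_diff_right)
  qed
  then have pfun: "minkowski_support K c z = p" by auto
  define v where "v \<theta> = c (\<psi> \<theta>) - z" for \<theta>
  define rad where "rad \<theta> = speed (\<psi> \<theta>) / turning_rate (\<psi> \<theta>)" for \<theta>
  have dv: "((\<lambda>\<theta>. v \<theta> $ 1) has_real_derivative - rad \<theta> * sin \<theta>) (at \<theta>)"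
     "((\<lambda>\<theta>. v \<theta> $ 2) has_real_derivative rad \<theta> * cos \<theta>) (at \<theta>)" for \<theta>
  proof -
    have "c1 (\<psi> \<theta>) $ 2 = speed (\<psi> \<theta>) * cos \<theta>" "c1 (\<psi> \<theta>) $ 1 = - (speed (\<psi> \<theta>) * sin \<theta>)"
      using arg_cong[OF n\<psi>[of \<theta>], of "\<lambda>v. v $ 1"] arg_cong[OF n\<psi>[of \<theta>], of "\<lambda>v. v $ 2"]
      by (simp_all add: normal_def)
    note c1\<psi> = this
    have dvi: "((\<lambda>\<theta>. v \<theta> $ i) has_real_derivative c1 (\<psi> \<theta>) $ i * (1 / turning_rate (\<psi> \<theta>))) (at \<theta>)" for i
    proof -
      have "((\<lambda>\<theta>. c (\<psi> \<theta>) $ i) has_real_derivative c1 (\<psi> \<theta>) $ i * (1 / turning_rate (\<psi> \<theta>))) (at \<theta>)"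
        by (rule DERIV_chain2[where g = \<psi>, OF has_real_derivative_nth[OF der] d\<psi>])
      then show ?thesis unfolding v_def by (auto intro!: derivative_eq_intros)
    qed
    show "((\<lambda>\<theta>. v \<theta> $ 1) has_real_derivative - rad \<theta> * sin \<theta>) (at \<theta>)"
     "((\<lambda>\<theta>. v \<theta> $ 2) has_real_derivative rad \<theta> * cos \<theta>) (at \<theta>)"
      using dvi[of 1] dvi[of 2] by (simp_all add: rad_def c1\<psi>)
  qed
  have pv: "p \<theta> = cos \<theta> * v \<theta> $ 1 + sin \<theta> * v \<theta> $ 2" for \<theta>
    by (simp add: p_def v_def inner_real2)
  define p1 where "p1 \<theta> = cos \<theta> * v \<theta> $ 2 - sin \<theta> * v \<theta> $ 1" for \<theta>
  define p2 where "p2 \<theta> = rad \<theta> - p \<theta>" for \<theta>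
  have dp: "(p has_real_derivative p1 \<theta>) (at \<theta>)" for \<theta>
    unfolding pv[abs_def] p1_def by (auto intro!: derivative_eq_intros dv simp: algebra_simps)
  have dp1: "(p1 has_real_derivative p2 \<theta>) (at \<theta>)" for \<theta>
  proof -
    have "(p1 has_real_derivative - sin \<theta> * v \<theta> $ 2 + rad \<theta> * cos \<theta> * cos \<theta>
        - (cos \<theta> * v \<theta> $ 1 + - rad \<theta> * sin \<theta> * sin \<theta>)) (at \<theta>)"
      unfolding p1_def by (auto intro!: derivative_eq_intros dv)
    also have "- sin \<theta> * v \<theta> $ 2 + rad \<theta> * cos \<theta> * cos \<theta>
        - (cos \<theta> * v \<theta> $ 1 + - rad \<theta> * sin \<theta> * sin \<theta>) =
        rad \<theta> * (cos \<theta> * cos \<theta> + sin \<theta> * sin \<theta>) - p \<theta>"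
      unfolding pv by (simp add: algebra_simps del: sin_cos_squared_add3)
    finally show ?thesis by (simp add: p2_def)
  qed
  have c\<psi>: "continuous_on A \<psi>" for A by (rule deriv_imp_continuous_on_UNIV[OF d\<psi>])
  have tr0: "turning_rate t \<noteq> 0" for t using turning_rate_pos[of t] by simp
  have crad: "continuous_on UNIV rad"
    unfolding rad_def using tr0
    by (intro continuous_on_divide continuous_on_compose2[OF continuous_speed c\<psi>]
        continuous_on_compose2[OF continuous_turning_rate c\<psi>]) auto
  then have cp2: "continuous_on UNIV p2"
    unfolding p2_def by (intro continuous_intros deriv_imp_continuous_on_UNIV[OF dp])
  have perv: "v (\<theta> + 2 * pi) = v \<theta>" for \<theta> by (simp add: v_def per\<psi> per)
  have perp: "p (\<theta> + 2 * pi) = p \<theta>" "p1 (\<theta> + 2 * pi) = p1 \<theta>" for \<theta>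
    by (simp_all add: pv p1_def perv)
  have subst: "integral {0..T} f = integral {0..2*pi} (\<lambda>\<theta>. f (\<psi> \<theta>) / turning_rate (\<psi> \<theta>))"
    if cf: "continuous_on UNIV f" and pf: "\<And>t. f (t + T) = f t" for f :: "real \<Rightarrow> real"
  proof -
    obtain F where F: "\<And>t. (F has_real_derivative f t) (at t)"
      using antiderivative_on_UNIV[OF cf] by blast
    have "integral {0..T} f = F T - F 0"
      using integral_eq_increment[OF F, of 0 T] T by (simp add: integral_unique)
    also have "\<dots> = F (\<psi> (\<theta>0 + 2 * pi)) - F (\<psi> \<theta>0)" by (simp add: per\<psi> \<theta>0)
    also have "\<dots> = integral {\<theta>0..\<theta>0 + 2 * pi} (\<lambda>\<theta>. f (\<psi> \<theta>) * (1 / turning_rate (\<psi> \<theta>)))"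
      by (rule integral_unique[symmetric], rule integral_eq_increment[of "\<lambda>\<theta>. F (\<psi> \<theta>)"])
         (simp_all only: DERIV_chain2[where g = \<psi>, OF F d\<psi>], simp)
    also have "\<dots> = integral {0..2*pi} (\<lambda>\<theta>. f (\<psi> \<theta>) * (1 / turning_rate (\<psi> \<theta>)))"
    proof (rule integral_over_period)
      show "continuous_on UNIV (\<lambda>\<theta>. f (\<psi> \<theta>) * (1 / turning_rate (\<psi> \<theta>)))"
        using tr0 by (intro continuous_on_mult continuous_on_divide continuous_on_const
            continuous_on_compose2[OF cf c\<psi>] continuous_on_compose2[OF continuous_turning_rate c\<psi>]) auto
    qed (simp_all add: per\<psi> pf turning_rate_periodic)
    finally show ?thesis by simp
  qed
  have len: "curve_length c T = integral {0..2*pi} p"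
  proof -
    have "curve_length c T = integral {0..T} speed"
      by (simp add: curve_length_def vd speed_def[abs_def])
    also have "\<dots> = integral {0..2*pi} (\<lambda>\<theta>. p \<theta> + p2 \<theta>)"
      using subst[OF continuous_speed speed_periodic] by (simp add: p2_def rad_def)
    also have "\<dots> = integral {0..2*pi} p + integral {0..2*pi} p2"
      by (intro integral_add integrable_continuous_interval deriv_imp_continuous_on_UNIV[OF dp]
          continuous_on_subset[OF cp2]) auto
    also have "integral {0..2*pi} p2 = p1 (0 + 2 * pi) - p1 0"
      using integral_eq_increment[OF dp1, of 0 "2 * pi"] by (simp add: integral_unique)
    finally show ?thesis by (simp only: perp)
  qed
  have area: "measure lebesgue K = 1 / 2 * integral {0..2*pi} (\<lambda>\<theta>. p \<theta> * (p \<theta> + p2 \<theta>))"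
  proof -
    define g where "g t = cross2 (c t - z) (c1 t)" for t
    have "g (\<psi> \<theta>) / turning_rate (\<psi> \<theta>) = p \<theta> * (p \<theta> + p2 \<theta>)" for \<theta>
    proof -
      have "g (\<psi> \<theta>) = speed (\<psi> \<theta>) * p \<theta>"
        unfolding g_def normal_inner[symmetric] n\<psi> p_def by simp
      then show ?thesis by (simp add: p2_def rad_def)
    qed
    moreover have "integral {0..T} g = integral {0..2*pi} (\<lambda>\<theta>. g (\<psi> \<theta>) / turning_rate (\<psi> \<theta>))"
    proof (rule subst)
      show "continuous_on UNIV g"
        unfolding g_def cross2_def by (intro continuous_intros continuous_c continuous_c1)
    qed (simp add: g_def per per1)
    ultimately show ?thesis unfolding area_eq g_def[symmetric] by simp
  qed
  show ?thesis
    by (rule that[of p1 p2]; (unfold pfun)?)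
       (use dp dp1 cp2 perp len area out p_def in blast)+
qed

end

section \<open>Both orientations of an oval\<close>

lemma oval_has_vector_derivative:
  assumes "oval c T"
  shows "(c has_vector_derivative vderiv c t) (at t)"
    and "(vderiv c has_vector_derivative vderiv (vderiv c) t) (at t)"
    and "continuous_on UNIV (vderiv (vderiv c))"
proof -
  have diff: "((vderiv ^^ k) c has_vector_derivative (vderiv ^^ Suc k) c t) (at t)" for k t
    using assms unfolding oval_def smooth_curve_def
    by (simp add: vector_derivative_works vderiv_def)
  show "(c has_vector_derivative vderiv c t) (at t)" using diff[of 0 t] by simp
  show "(vderiv c has_vector_derivative vderiv (vderiv c) t) (at t)" using diff[of 1 t] by simp
  show "continuous_on UNIV (vderiv (vderiv c))"
    using diff[of 2] by (intro continuous_at_imp_continuous_on ballI has_vector_derivative_continuous)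
      (simp add: numeral_2_eq_2)
qed

lemma positive_oval_of_positive_curvature:
  assumes "strictly_convex_domain K" "oval c T" "frontier K = c ` {0..T}" "z \<in> interior K"
    and pos: "\<And>t. signed_curvature c t > 0"
  shows "positive_oval K c (vderiv c) (vderiv (vderiv c)) T z"
proof
  show "cross2 (vderiv c t) (vderiv (vderiv c) t) > 0" for t
    using pos[of t] by (simp add: signed_curvature_def zero_less_divide_iff)
qed (use assms oval_has_vector_derivative[OF assms(2)] in \<open>auto simp: oval_def\<close>)

text \<open>Reversing the direction changes the sign of the first derivative and keeps the second, so it changes
the sign of the curvature.\<close>
lemma positive_oval_of_negative_curvature:
  assumes "strictly_convex_domain K" "oval c T" "frontier K = c ` {0..T}" "z \<in> interior K"
    and neg: "\<And>t. signed_curvature c t < 0"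
  shows "positive_oval K (\<lambda>t. c (- t)) (\<lambda>t. - vderiv c (- t)) (\<lambda>t. vderiv (vderiv c) (- t)) T z"
proof
  note d = oval_has_vector_derivative[OF assms(2)]
  have T: "0 < T" and per: "\<And>t. c (t + T) = c t" and inj: "inj_on c {0..<T}"
    using assms(2) by (auto simp: oval_def)
  have cT: "c (- t) = c (T - t)" for t using per[of "- t"] by simp
  have m: "(uminus has_vector_derivative (- 1)) (at t)" for t :: real
    by (auto intro!: derivative_eq_intros)
  show "((\<lambda>t. c (- t)) has_vector_derivative - vderiv c (- t)) (at t)" for t
    using vector_diff_chain_at[OF m d(1), of t] by (simp add: o_def)
  show "((\<lambda>t. - vderiv c (- t)) has_vector_derivative vderiv (vderiv c) (- t)) (at t)" for t
    using has_vector_derivative_minus[OF vector_diff_chain_at[OF m d(2), of t]] by (simp add: o_def)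
  show "continuous_on UNIV (\<lambda>t. vderiv (vderiv c) (- t))"
    by (intro continuous_on_compose2[OF d(3)] continuous_intros) auto
  show "c (- (t + T)) = c (- t)" for t using per[of "- t - T"] by simp
  show "inj_on (\<lambda>t. c (- t)) {0..<T}"
  proof (rule inj_onI)
    fix s t assume st: "s \<in> {0..<T}" "t \<in> {0..<T}" "c (- s) = c (- t)"
    \<comment> \<open>the point \<open>- s\<close> moved by a multiple of the period into the interval on which \<open>c\<close> is injective\<close>
    define f where "f s = (if s = 0 then 0 else T - s)" for s
    have "c (- s) = c (f s)" for s using cT[of s] per[of 0] by (simp add: f_def)
    then have "c (f s) = c (f t)" using st(3) by simp
    moreover have "f s \<in> {0..<T}" "f t \<in> {0..<T}" using st by (auto simp: f_def)
    ultimately have "f s = f t" using inj by (auto dest: inj_onD)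
    then show "s = t" using st by (auto simp: f_def split: if_splits)
  qed
  show "cross2 (- vderiv c (- t)) (vderiv (vderiv c) (- t)) > 0" for t
    using neg[of "- t"] by (simp add: signed_curvature_def divide_less_0_iff) (simp add: cross2_def)
  show "frontier K = (\<lambda>t. c (- t)) ` {0..T}"
  proof -
    have "(\<lambda>t. c (- t)) ` {0..T} = c ` (\<lambda>t. T - t) ` {0..T}" by (simp only: cT image_image)
    also have "(\<lambda>t. T - t) ` {0..T} = {0..T}" by simp
    finally show ?thesis using assms(3) by simp
  qed
qed (use assms in \<open>auto simp: oval_def\<close>)

text \<open>The support function, the length and the set of points with a given outer normal do not depend on the
direction in which the curve is traversed.\<close>
lemma oval_support_function:
  assumes "strictly_convex_domain K" "oval c T" "frontier K = c ` {0..T}" "z \<in> interior K"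
  obtains p1 p2 where
    "\<And>\<theta>. (minkowski_support K c z has_real_derivative p1 \<theta>) (at \<theta>)"
    "\<And>\<theta>. (p1 has_real_derivative p2 \<theta>) (at \<theta>)"
    "continuous_on UNIV p2"
    "\<And>\<theta>. minkowski_support K c z (\<theta> + 2 * pi) = minkowski_support K c z \<theta>"
    "curve_length c T = integral {0..2*pi} (minkowski_support K c z)"
    "measure lebesgue K = 1 / 2 * integral {0..2*pi}
       (\<lambda>\<theta>. minkowski_support K c z \<theta> * (minkowski_support K c z \<theta> + p2 \<theta>))"
    "\<And>\<theta>. \<exists>t. outer_normal_at K c t (unit_dir \<theta>) \<and>
           minkowski_support K c z \<theta> = unit_dir \<theta> \<bullet> (c t - z)"
proof (cases "\<forall>t. signed_curvature c t > 0")
  case True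
  then interpret positive_oval K c "vderiv c" "vderiv (vderiv c)" T z
    using positive_oval_of_positive_curvature[OF assms] by blast
  show ?thesis by (rule support_function_properties) (rule that)
next
  case False
  then have neg: "\<And>t. signed_curvature c t < 0" using assms(2) by (auto simp: oval_def)
  define r where "r t = c (- t)" for t
  interpret R: positive_oval K r "\<lambda>t. - vderiv c (- t)" "\<lambda>t. vderiv (vderiv c) (- t)" T z
    using positive_oval_of_negative_curvature[OF assms neg] unfolding r_def[abs_def] .
  have vd: "vderiv r t = - vderiv c (- t)" for t
    unfolding vderiv_def[of r] by (rule vector_derivative_at[OF R.der])
  have out: "outer_normal_at K r t u \<longleftrightarrow> outer_normal_at K c (- t) u" for t u
    by (simp add: outer_normal_at_def vd r_def)
  have ex: "(\<exists>t. outer_normal_at K r t u \<and> h = u \<bullet> (r t - z)) \<longleftrightarrow>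
      (\<exists>t. outer_normal_at K c t u \<and> h = u \<bullet> (c t - z))" for u h
    unfolding out r_def by (metis minus_minus)
  have mink: "minkowski_support K r z = minkowski_support K c z"
    by (intro ext) (simp only: minkowski_support_def ex)
  have len: "curve_length r T = curve_length c T"
  proof -
    define f where "f t = norm (vderiv r t)" for t
    have "curve_length c T = integral {0..T} (\<lambda>t. f (- t))"
      by (simp add: curve_length_def f_def vd)
    also have "\<dots> = integral {- T..0} f"
      using Henstock_Kurzweil_Integration.integral_reflect_real[of 0 "- T" f] by simp
    also have "\<dots> = integral {- T..- T + T} f" by simp
    also have "\<dots> = integral {0..T} f"
    proof (rule integral_over_period)
      show "continuous_on UNIV f"
        unfolding f_def vd by (intro continuous_intros R.continuous_c1)
      show "f (t + T) = f t" for t unfolding f_def vd R.per1 ..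
    qed (use R.T in simp)
    also have "\<dots> = curve_length r T" by (simp add: curve_length_def f_def[abs_def])
    finally show ?thesis by simp
  qed
  show ?thesis
    by (rule R.support_function_properties; unfold mink len ex) (rule that)
qed

section \<open>Constant width\<close>

lemma orthogonal_to_same_imp_parallel:
  fixes u v w :: "real^2"
  assumes "u \<bullet> v = 0" "u \<bullet> w = 0" "u \<noteq> 0" "w \<noteq> 0"
  shows "\<exists>r. v = r *\<^sub>R w"
proof -
  define q where "q = (w$1)\<^sup>2 + (w$2)\<^sup>2"
  have q: "q > 0" using \<open>w \<noteq> 0\<close> by (auto simp: q_def vec_eq_iff forall_2 sum_power2_gt_zero_iff)
  have c: "cross2 v w = 0"
  proof -
    have e: "u$1 * v$1 + u$2 * v$2 = 0" "u$1 * w$1 + u$2 * w$2 = 0"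
      using assms(1,2) by (simp_all add: inner_real2)
    have "u$1 * cross2 v w = (u$1 * v$1 + u$2 * v$2) * w$2 - (u$1 * w$1 + u$2 * w$2) * v$2"
      "u$2 * cross2 v w = (u$1 * w$1 + u$2 * w$2) * v$1 - (u$1 * v$1 + u$2 * v$2) * w$1"
      by (simp_all add: cross2_def algebra_simps)
    then have "u$1 * cross2 v w = 0" "u$2 * cross2 v w = 0" unfolding e by simp_all
    then show ?thesis using \<open>u \<noteq> 0\<close> by (auto simp: vec_eq_iff forall_2)
  qed
  have "v$1 * q = (v \<bullet> w) * w$1 + cross2 v w * w$2" "v$2 * q = (v \<bullet> w) * w$2 - cross2 v w * w$1"
    by (simp_all add: q_def cross2_def inner_real2 algebra_simps power2_eq_square)
  then have "v = ((v \<bullet> w) / q) *\<^sub>R w"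
    using q unfolding c by (simp add: vec_eq_iff forall_2 field_simps)
  then show ?thesis by blast
qed

text \<open>The lower bound for the distance is the Cauchy-Schwarz inequality with the common normal \<open>u\<close>. It is
attained at \<open>c s\<close> and its orthogonal projection to the other line.\<close>
lemma distance_of_parallel_tangent_lines:
  assumes u: "norm u = 1" and s: "u \<bullet> vderiv c s = 0" "vderiv c s \<noteq> 0"
    and t: "u \<bullet> vderiv c t = 0" "vderiv c t \<noteq> 0" and gt: "u \<bullet> c s > u \<bullet> c t"
  shows "parallel_tangents c s t" "tangent_line c s \<noteq> tangent_line c t"
    "setdist (tangent_line c s) (tangent_line c t) = u \<bullet> c s - u \<bullet> c t"
proof -
  have u0: "u \<noteq> 0" using u by auto
  show "parallel_tangents c s t"
    unfolding parallel_tangents_def using orthogonal_to_same_imp_parallel[OF s(1) t(1) u0 t(2)] .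
  have inS: "u \<bullet> x = u \<bullet> c s" if "x \<in> tangent_line c s" for x
    using that s(1) by (auto simp: tangent_line_def inner_add_right)
  have inT: "u \<bullet> x = u \<bullet> c t" if "x \<in> tangent_line c t" for x
    using that t(1) by (auto simp: tangent_line_def inner_add_right)
  have cs: "c s \<in> tangent_line c s" by (auto simp: tangent_line_def intro!: exI[of _ 0])
  then show "tangent_line c s \<noteq> tangent_line c t" using inT gt by force
  have ct: "c t \<in> tangent_line c t" by (auto simp: tangent_line_def intro!: exI[of _ 0])
  define d where "d = u \<bullet> c s - u \<bullet> c t"
  have uu: "u \<bullet> u = 1" using u by (simp add: power2_norm_eq_inner[symmetric])
  have "u \<bullet> (c s - d *\<^sub>R u - c t) = 0" by (simp add: inner_diff_right uu d_def)
  then obtain r where "c s - d *\<^sub>R u - c t = r *\<^sub>R vderiv c t"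
    using orthogonal_to_same_imp_parallel[OF _ t(1) u0 t(2)] by blast
  then have foot: "c s - d *\<^sub>R u \<in> tangent_line c t"
    by (auto simp: tangent_line_def algebra_simps intro!: exI[of _ r])
  have "setdist (tangent_line c s) (tangent_line c t) \<le> dist (c s) (c s - d *\<^sub>R u)"
    by (rule setdist_le_dist[OF cs foot])
  also have "\<dots> = d" using u gt by (simp add: dist_norm d_def)
  finally have le: "setdist (tangent_line c s) (tangent_line c t) \<le> d" .
  have "d \<le> setdist (tangent_line c s) (tangent_line c t)"
  proof (rule le_setdistI)
    fix x y assume "x \<in> tangent_line c s" "y \<in> tangent_line c t"
    then have "d = u \<bullet> (x - y)" using inS inT by (simp add: d_def inner_diff_right)
    also have "\<dots> \<le> dist x y" using norm_cauchy_schwarz[of u "x - y"] u by (simp add: dist_norm)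
    finally show "d \<le> dist x y" .
  qed (use cs ct in auto)
  then show "setdist (tangent_line c s) (tangent_line c t) = u \<bullet> c s - u \<bullet> c t"
    using le by (simp add: d_def)
qed

text \<open>The tangent lines with outer normals \<open>u\<close> and \<open>- u\<close> are distinct, because the domain has interior
points, and their distance is \<open>p \<theta> + p (\<theta> + pi)\<close>.\<close>
lemma constant_width_imp_constant_sum:
  assumes cw: "constant_width c"
    and reg: "\<And>t. vderiv c t \<noteq> 0" and z: "z \<in> interior K"
    and sup: "\<And>\<theta>. \<exists>t. outer_normal_at K c t (unit_dir \<theta>) \<and>
           minkowski_support K c z \<theta> = unit_dir \<theta> \<bullet> (c t - z)"
  obtains w where "\<And>\<theta>. minkowski_support K c z \<theta> + minkowski_support K c z (\<theta> + pi) = w"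
proof -
  from cw obtain w where w: "\<forall>s t. parallel_tangents c s t \<and> tangent_line c s \<noteq> tangent_line c t \<longrightarrow>
      setdist (tangent_line c s) (tangent_line c t) = w"
    unfolding constant_width_def by (rule exE)
  have "minkowski_support K c z \<theta> + minkowski_support K c z (\<theta> + pi) = w" for \<theta>
  proof -
    define u where "u = unit_dir \<theta>"
    have u1: "norm u = 1" by (simp add: u_def)
    obtain s where s: "outer_normal_at K c s u" "minkowski_support K c z \<theta> = u \<bullet> (c s - z)"
      using sup[of \<theta>] unfolding u_def by blast
    obtain t where t: "outer_normal_at K c t (- u)"
        "minkowski_support K c z (\<theta> + pi) = - u \<bullet> (c t - z)"
      using sup[of "\<theta> + pi"] unfolding unit_dir_add_pi u_def[symmetric] by blast
    have uu: "u \<bullet> u = 1" using u1 by (simp add: power2_norm_eq_inner[symmetric])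
    obtain e where e: "e > 0" "cball z e \<subseteq> K" using z by (meson mem_interior_cball)
    have "z + e *\<^sub>R u \<in> K" "z \<in> K" using e u1 by (auto simp: dist_norm)
    then have "u \<bullet> (z + e *\<^sub>R u - c s) \<le> 0" "- u \<bullet> (z - c t) \<le> 0"
      using s(1) t(1) unfolding outer_normal_at_def by blast+
    then have gt: "u \<bullet> c s > u \<bullet> c t"
      using e(1) uu by (simp add: inner_add_right inner_diff_right)
    have "u \<bullet> vderiv c s = 0" "u \<bullet> vderiv c t = 0"
      using s(1) t(1) by (auto simp: outer_normal_at_def)
    note d = distance_of_parallel_tangent_lines[OF u1 this(1) reg this(2) reg gt]
    have "u \<bullet> c s - u \<bullet> c t = w" using w[rule_format, OF conjI[OF d(1,2)]] d(3) by simp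
    then show ?thesis using s(2) t(2) by (simp add: inner_diff_right)
  qed
  then show ?thesis using that by blast
qed

section \<open>The sharpened isoperimetric inequality\<close>

theorem theorem4p5:
  fixes K :: "(real^2) set" and c :: "real \<Rightarrow> real^2" and T :: real and z :: "real^2"
  assumes "strictly_convex_domain K"
    and "oval c T"
    and "frontier K = c ` {0..T}"
    and "z \<in> interior K"
  shows
    "let p = minkowski_support K c z;
         L = curve_length c T;
         A = measure lebesgue K;
         lhs = L\<^sup>2 - 4 * pi * A - 8 * pi * \<bar>wigner_caustic_area p\<bar>;
         rhs = 6 * pi * (d2 p (wigner_type_support L p))\<^sup>2
     in lhs \<ge> rhs \<and>
        (lhs = rhs \<longleftrightarrow>
           constant_width c \<or>
           (\<exists>a b :: nat \<Rightarrow> real. \<forall>\<theta>.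
              (\<lambda>n. if odd n then a n * cos (real n * \<theta>) + b n * sin (real n * \<theta>) else 0)
                sums (p \<theta> - (a 0 + a 2 * cos (2 * \<theta>) + b 2 * sin (2 * \<theta>)))))"
proof -
  define p where "p = minkowski_support K c z"
  obtain p1 p2 where der: "\<And>\<theta>. (p has_real_derivative p1 \<theta>) (at \<theta>)"
    and der1: "\<And>\<theta>. (p1 has_real_derivative p2 \<theta>) (at \<theta>)"
    and cont: "continuous_on UNIV p2"
    and per: "\<And>\<theta>. p (\<theta> + 2 * pi) = p \<theta>"
    and len: "curve_length c T = integral {0..2*pi} p"
    and area: "measure lebesgue K = 1 / 2 * integral {0..2*pi} (\<lambda>\<theta>. p \<theta> * (p \<theta> + p2 \<theta>))"
    and sup: "\<And>\<theta>. \<exists>t. outer_normal_at K c t (unit_dir \<theta>) \<and> p \<theta> = unit_dir \<theta> \<bullet> (c t - z)"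
    using oval_support_function[OF assms] unfolding p_def by blast
  have reg: "vderiv c t \<noteq> 0" for t using assms(2) by (simp add: oval_def)
  note ineq = isoperimetric_wigner_inequality[OF der der1 cont per, folded len area]
  have cw: "\<exists>C A B. \<forall>\<theta>. (p \<theta> + p (\<theta> + pi)) / 2 = C + A * cos (2 * \<theta>) + B * sin (2 * \<theta>)"
    if cwc: "constant_width c"
  proof -
    obtain w where "\<And>\<theta>. p \<theta> + p (\<theta> + pi) = w"
      using constant_width_imp_constant_sum[OF cwc reg assms(4)] sup unfolding p_def by blast
    then have "\<forall>\<theta>. (p \<theta> + p (\<theta> + pi)) / 2 = w / 2 + 0 * cos (2 * \<theta>) + 0 * sin (2 * \<theta>)" by simp
    then show ?thesis by blast
  qed
  show ?thesis
    unfolding Let_def p_def[symmetric]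
    using ineq cw even_part_second_harmonic_iff_fourier_series[OF der per] by blast
qed

end
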